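(* Any prime $C^*$-algebra is of one of the following five types: discrete and finite; discrete and essentially infinite; of type II and finite; of type II and essentially infinite; of type III.
   Context: A $C^*$-algebra $A$ is prime if $\{0\}$ is a prime ideal of $A$; equivalently, $A$ has no non-trivial normal ideal, where a normal ideal is one of the form $J^\perp=\{a\in A: aJ=\{0\}=Ja\}$ for an ideal $J\subseteq A$. $A_+$ is the positive cone of $A$; $a\in A_+$ dominates $b\in A_+$ if $b\le a$. An element $x\in A_+$ is abelian in $A$ if $\overline{xAx}$ is commutative. For $x,y\in A_+$ write $x\sim y$ if there is a sequence $(z_k)_{k\in\mathbb N}$ in $A$ with $x=\sum_{k=1}^\infty z_k^*z_k$ and $y=\sum_{k=1}^\infty z_kz_k^*$ (norm convergence). An element $x\in A_+$ is finite in $A$ if $y=x$ whenever $y\in A_+$, $0\le y\le x$ and $y\sim x$. $A$ is: discrete if every non-zero element of $A_+$ dominates a non-zero abelian element of $A$; finite if every non-zero element of $A_+$ is finite in $A$; semi-finite if every non-zero element of $A_+$ dominates a non-zero positive element that is finite in $A$; of type II if it has no non-zero abelian element and is semi-finite; of type III if it has no non-zero finite element; essentially infinite if it contains no non-zero finite closed ideal. *)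

theory Defs
  imports "HOL-Analysis.Analysis"
begin

text \<open>
  C*-algebras over the complex numbers, not assumed to be unital. Submultiplicativity of the norm
  comes from \<^class>\<open>real_normed_algebra\<close>, completeness from \<^class>\<open>banach\<close>.
\<close>

class cstar_algebra = real_normed_algebra + banach +
  fixes scaleC :: "complex \<Rightarrow> 'a \<Rightarrow> 'a"  (infixr \<open>*\<^sub>C\<close> 75)
    and star :: "'a \<Rightarrow> 'a"
  assumes scaleC_of_real: "complex_of_real r *\<^sub>C x = r *\<^sub>R x"
    and scaleC_add_right: "c *\<^sub>C (x + y) = c *\<^sub>C x + c *\<^sub>C y"
    and scaleC_add_left: "(c + d) *\<^sub>C x = c *\<^sub>C x + d *\<^sub>C x"
    and scaleC_scaleC: "c *\<^sub>C d *\<^sub>C x = (c * d) *\<^sub>C x"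
    and mult_scaleC_left: "(c *\<^sub>C x) * y = c *\<^sub>C (x * y)"
    and mult_scaleC_right: "x * (c *\<^sub>C y) = c *\<^sub>C (x * y)"
    and norm_scaleC: "norm (c *\<^sub>C x) = cmod c * norm x"
    and star_star: "star (star x) = x"
    and star_add: "star (x + y) = star x + star y"
    and star_scaleC: "star (c *\<^sub>C x) = cnj c *\<^sub>C star x"
    and star_mult: "star (x * y) = star y * star x"
    and cstar_identity: "norm (star x * x) = (norm x)\<^sup>2"

instantiation complex :: cstar_algebra
begin

definition scaleC_complex :: "complex \<Rightarrow> complex \<Rightarrow> complex" where
  "scaleC_complex c x = c * x"

definition star_complex :: "complex \<Rightarrow> complex" where
  "star_complex = cnj"

instance
  by standard (simp_all add: scaleC_complex_def star_complex_def scaleR_conv_of_real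
      algebra_simps norm_mult power2_eq_square)

end

text \<open>
  The notions below take the C*-algebra as a set \<open>B\<close>: either the whole type (\<open>B = UNIV\<close>) or a
  closed *-subalgebra of it. This is needed because closed ideals are themselves regarded as
  C*-algebras, so that finiteness of an ideal \<open>J\<close> refers to positive elements of \<open>J\<close> and to
  implementing sequences in \<open>J\<close>.
\<close>

definition cstar_pos :: "'a::cstar_algebra set \<Rightarrow> 'a set" where
  "cstar_pos B = {star z * z | z. z \<in> B}"

definition cstar_le :: "'a::cstar_algebra set \<Rightarrow> 'a \<Rightarrow> 'a \<Rightarrow> bool" where
  "cstar_le B b a \<longleftrightarrow> a - b \<in> cstar_pos B"

definition cstar_ideal :: "'a::cstar_algebra set \<Rightarrow> 'a set \<Rightarrow> bool" where
  "cstar_ideal B J \<longleftrightarrow> J \<subseteq> B \<and> 0 \<in> J \<and>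
     (\<forall>x\<in>J. \<forall>y\<in>J. x + y \<in> J) \<and> (\<forall>c. \<forall>x\<in>J. c *\<^sub>C x \<in> J) \<and>
     (\<forall>a\<in>B. \<forall>x\<in>J. a * x \<in> J \<and> x * a \<in> J)"

text \<open>
  Properness of a prime ideal is deliberately not required, so that the zero algebra counts as
  prime. This agrees with the characterisation of primeness by the absence of non-trivial normal
  ideals.
\<close>

definition cstar_prime_ideal :: "'a::cstar_algebra set \<Rightarrow> 'a set \<Rightarrow> bool" where
  "cstar_prime_ideal B P \<longleftrightarrow> cstar_ideal B P \<and>
     (\<forall>I J. cstar_ideal B I \<longrightarrow> cstar_ideal B J \<longrightarrow> (\<forall>x\<in>I. \<forall>y\<in>J. x * y \<in> P) \<longrightarrow>
        I \<subseteq> P \<or> J \<subseteq> P)"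

definition cstar_prime :: "'a::cstar_algebra set \<Rightarrow> bool" where
  "cstar_prime B \<longleftrightarrow> cstar_prime_ideal B {0}"

definition abelian_in :: "'a::cstar_algebra set \<Rightarrow> 'a \<Rightarrow> bool" where
  "abelian_in B x \<longleftrightarrow> x \<in> cstar_pos B \<and>
     (\<forall>u \<in> closure {x * a * x | a. a \<in> B}. \<forall>v \<in> closure {x * a * x | a. a \<in> B}. u * v = v * u)"

definition cstar_equiv :: "'a::cstar_algebra set \<Rightarrow> 'a \<Rightarrow> 'a \<Rightarrow> bool" where
  "cstar_equiv B x y \<longleftrightarrow> x \<in> cstar_pos B \<and> y \<in> cstar_pos B \<and>
     (\<exists>z :: nat \<Rightarrow> 'a. (\<forall>k. z k \<in> B) \<and>
        (\<lambda>k. star (z k) * z k) sums x \<and> (\<lambda>k. z k * star (z k)) sums y)"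

definition finite_in :: "'a::cstar_algebra set \<Rightarrow> 'a \<Rightarrow> bool" where
  "finite_in B x \<longleftrightarrow> x \<in> cstar_pos B \<and>
     (\<forall>y \<in> cstar_pos B. cstar_le B y x \<longrightarrow> cstar_equiv B y x \<longrightarrow> y = x)"

definition cstar_discrete :: "'a::cstar_algebra set \<Rightarrow> bool" where
  "cstar_discrete B \<longleftrightarrow>
     (\<forall>a \<in> cstar_pos B. a \<noteq> 0 \<longrightarrow> (\<exists>b. abelian_in B b \<and> b \<noteq> 0 \<and> cstar_le B b a))"

definition cstar_finite :: "'a::cstar_algebra set \<Rightarrow> bool" where
  "cstar_finite B \<longleftrightarrow> (\<forall>a \<in> cstar_pos B. a \<noteq> 0 \<longrightarrow> finite_in B a)"

definition cstar_semifinite :: "'a::cstar_algebra set \<Rightarrow> bool" where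
  "cstar_semifinite B \<longleftrightarrow>
     (\<forall>a \<in> cstar_pos B. a \<noteq> 0 \<longrightarrow> (\<exists>b. finite_in B b \<and> b \<noteq> 0 \<and> cstar_le B b a))"

definition cstar_type_II :: "'a::cstar_algebra set \<Rightarrow> bool" where
  "cstar_type_II B \<longleftrightarrow> (\<nexists>x. abelian_in B x \<and> x \<noteq> 0) \<and> cstar_semifinite B"

definition cstar_type_III :: "'a::cstar_algebra set \<Rightarrow> bool" where
  "cstar_type_III B \<longleftrightarrow> (\<nexists>x. finite_in B x \<and> x \<noteq> 0)"

definition cstar_essentially_infinite :: "'a::cstar_algebra set \<Rightarrow> bool" where
  "cstar_essentially_infinite B \<longleftrightarrow>
     (\<nexists>J. cstar_ideal B J \<and> closed J \<and> J \<noteq> {0} \<and> cstar_finite J)"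

end

theory Submission
  imports Defs
begin

text \<open>
  Primeness connects any two non-zero elements: for \<open>x \<noteq> 0\<close> and \<open>a = s\<^sup>* s \<noteq> 0\<close> there is a
  contraction \<open>x c\<close> with \<open>z = x c s \<noteq> 0\<close>, and then \<open>0 \<noteq> z\<^sup>* z \<le> a\<close>. If \<open>x\<close> is abelian, so is
  \<open>z\<^sup>* z\<close>, because \<open>z A z\<^sup>* \<subseteq> x A x\<close>. If \<open>x\<close> is finite, use its square root instead of \<open>x\<close>: then
  \<open>z\<^sup>* z \<sim> z z\<^sup>* \<le> x\<close>, so \<open>z\<^sup>* z\<close> is finite. Hence one non-zero abelian (finite) element yields
  one below every \<open>a\<close>.

  Let \<open>J\<close> be a non-zero finite closed ideal and suppose that \<open>y \<le> a\<close>, \<open>y \<sim> a\<close> and \<open>d = a - y \<noteq> 0\<close>.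
  From \<open>y + d \<sim> y\<close> we get \<open>y + n d \<sim> y\<close> for all \<open>n\<close>, so every positive \<open>j \<le> d\<close> satisfies
  \<open>n j \<sim> w \<le> y\<close> by Riesz decomposition, and hence is equivalent to elements of arbitrarily small
  norm. Choose \<open>0 \<noteq> j \<le> d\<close> in \<open>J\<close> and \<open>j \<sim> w\<^sub>n\<close> with \<open>\<Sum> w\<^sub>n\<close> convergent: this sum is equivalent to
  its own tail, contradicting finiteness of \<open>J\<close>.

  Transitivity and Riesz decomposition for \<open>\<sim>\<close> rest on the elements \<open>t D\<^sup>-\<^sup>1\<^sup>/\<^sup>2 p\<close> for
  \<open>t\<^sup>* t, p p\<^sup>* \<le> D\<close>.
\<close>

section \<open>Square roots\<close>

lemma star_zero [simp]: "star (0::'a::cstar_algebra) = 0"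
  using star_add[of "0::'a" 0] by simp

lemma star_minus: "star (- x) = - star (x::'a::cstar_algebra)"
  using star_add[of x "- x"] by (simp add: eq_neg_iff_add_eq_0 add.commute)

lemma star_diff: "star (x - y) = star x - star (y::'a::cstar_algebra)"
  using star_add[of x "- y"] by (simp add: star_minus)

lemma star_scaleR: "star (r *\<^sub>R x) = r *\<^sub>R star (x::'a::cstar_algebra)"
  using star_scaleC[of "complex_of_real r" x] by (simp add: scaleC_of_real)

lemma norm_star: "norm (star x) = norm (x::'a::cstar_algebra)"
proof -
  have le: "norm y \<le> norm (star y)" for y :: 'a
  proof (cases "y = 0")
    case False
    have "norm y * norm y \<le> norm (star y) * norm y"
      using norm_mult_ineq[of "star y" y] by (simp add: cstar_identity power2_eq_square)
    then show ?thesis using False by simp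
  qed simp
  show ?thesis using le[of x] le[of "star x"] by (simp add: star_star)
qed

lemma norm_mult_star: "norm (x * star x) = (norm (x::'a::cstar_algebra))\<^sup>2"
  using cstar_identity[of "star x"] by (simp add: star_star norm_star)

lemma star_mult_self_eq_0: "star x * x = 0 \<longleftrightarrow> (x::'a::cstar_algebra) = 0"
  using cstar_identity[of x] by (metis norm_eq_zero zero_eq_power2 mult_zero_right)

lemma bounded_linear_star: "bounded_linear (star :: 'a::cstar_algebra \<Rightarrow> 'a)"
  by (rule bounded_linear_intro[where K = 1]) (simp_all add: star_add star_scaleR norm_star)

lemmas tendsto_star = bounded_linear.tendsto[OF bounded_linear_star]

text \<open>Take \<open>y = star a\<close> and use the C*-identity. Bounds for left multiplication
  operators thus become bounds for elements.\<close>

lemma norm_le_of_left_mult: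
  fixes a :: "'a::cstar_algebra"
  assumes "\<And>y. norm (a * y) \<le> K * norm y" "0 \<le> K"
  shows "norm a \<le> K"
proof (cases "a = 0")
  case False
  have "norm a * norm a \<le> K * norm a"
    using assms(1)[of "star a"] by (simp add: norm_mult_star power2_eq_square norm_star)
  then show ?thesis using False by simp
qed (use assms in simp)

text \<open>
  To take the square root \<open>1 - q\<close> of \<open>1 - c\<close>, where \<open>\<parallel>c\<parallel> \<le> 1\<close>, iterate \<open>q \<mapsto> (c + q\<^sup>2) / 2\<close> from
  \<open>q = 0\<close>. In the unitization \<open>c = k - a\<close> and the iterates are \<open>sqrt_iter_real k n - sqrt_iter k a n\<close>.
  Norms of increments are majorized by those of the scalar iteration with \<open>k = 1\<close>.
\<close>

primrec sqrt_iter_real :: "real \<Rightarrow> nat \<Rightarrow> real" where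
  "sqrt_iter_real k 0 = 0"
| "sqrt_iter_real k (Suc n) = (k + (sqrt_iter_real k n)\<^sup>2) / 2"

primrec sqrt_iter :: "real \<Rightarrow> 'a::cstar_algebra \<Rightarrow> nat \<Rightarrow> 'a" where
  "sqrt_iter k a 0 = 0"
| "sqrt_iter k a (Suc n) = (1/2) *\<^sub>R (a + (2 * sqrt_iter_real k n) *\<^sub>R sqrt_iter k a n
      - sqrt_iter k a n * sqrt_iter k a n)"

lemma sqrt_iter_real_bounds:
  assumes "0 \<le> k" "k \<le> 1"
  shows "0 \<le> sqrt_iter_real k n \<and> sqrt_iter_real k n \<le> 1"
proof (induction n)
  case (Suc n)
  then have "(sqrt_iter_real k n)\<^sup>2 \<le> 1" by (simp add: power_le_one)
  then show ?case using assms by simp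
qed simp

lemma sqrt_iter_real_Suc_mono:
  assumes "0 \<le> k" "k \<le> 1"
  shows "sqrt_iter_real k n \<le> sqrt_iter_real k (Suc n)"
proof (induction n)
  case (Suc n)
  have "(sqrt_iter_real k n)\<^sup>2 \<le> (sqrt_iter_real k (Suc n))\<^sup>2"
    by (rule power_mono[OF Suc]) (use sqrt_iter_real_bounds[OF assms] in blast)
  then have "(k + (sqrt_iter_real k n)\<^sup>2) / 2 \<le> (k + (sqrt_iter_real k (Suc n))\<^sup>2) / 2"
    by simp
  then show ?case by (simp only: sqrt_iter_real.simps(2))
qed (use assms in simp)

text \<open>The monotone limit \<open>L\<close> is a fixed point, so
  \<open>(1 - L)\<^sup>2 = 1 - k\<close>; the bound \<open>L \<le> 1\<close> selects the nonnegative
  root.\<close>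

lemma sqrt_iter_real_tendsto:
  assumes "0 \<le> k" "k \<le> 1"
  shows "sqrt_iter_real k \<longlonglongrightarrow> 1 - sqrt (1 - k)"
proof -
  have inc: "incseq (sqrt_iter_real k)"
    by (rule incseq_SucI) (rule sqrt_iter_real_Suc_mono[OF assms])
  obtain L where L: "sqrt_iter_real k \<longlonglongrightarrow> L"
    using incseq_convergent[OF inc, of 1] sqrt_iter_real_bounds[OF assms] by blast
  have "(\<lambda>n. sqrt_iter_real k (Suc n)) \<longlonglongrightarrow> (k + L\<^sup>2) / 2"
    unfolding sqrt_iter_real.simps by (intro tendsto_intros L) simp
  with LIMSEQ_Suc[OF L] have "L = (k + L\<^sup>2) / 2" using LIMSEQ_unique by blast
  then have "2 * L = 2 * ((k + L\<^sup>2) / 2)" by (rule arg_cong)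
  then have "(1 - L)\<^sup>2 = 1 - k" by (simp add: power2_diff)
  moreover have "L \<le> 1" using LIMSEQ_le_const2[OF L, of 1] sqrt_iter_real_bounds[OF assms] by blast
  ultimately have "sqrt (1 - k) = 1 - L" by (metis diff_ge_0_iff_ge real_sqrt_unique)
  then show ?thesis using L by simp
qed

text \<open>In the unitization \<open>sqrt (1 - k) + x\<close> is the square root of
  \<open>(1 - k) + a\<close>. The last clause lets the root inherit the commutation relations of
  \<open>a\<close>.\<close>

lemma unit_sqrt_exists:
  fixes a :: "'a::cstar_algebra"
  assumes sa: "star a = a" and k: "0 \<le> k" "k \<le> 1"
    and C: "\<And>y. norm (k *\<^sub>R y - a * y) \<le> norm y"
  obtains x where "star x = x" "(2 * sqrt (1 - k)) *\<^sub>R x + x * x = a"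
    "\<And>y. norm ((1 - sqrt (1 - k)) *\<^sub>R y - x * y) \<le> norm y"
    "\<And>w. w * a = a * w \<Longrightarrow> w * x = x * w"
proof -
  let ?m = "sqrt_iter_real k" and ?r = "sqrt_iter_real 1" and ?x = "sqrt_iter k a"
  define q where "q n y = ?m n *\<^sub>R y - ?x n * y" for n y
  have q_Suc: "q (Suc n) y = (1/2) *\<^sub>R ((k *\<^sub>R y - a * y) + q n (q n y))" for n y
    by (simp add: q_def algebra_simps power2_eq_square add_divide_distrib) (simp flip: scaleR_add_left)
  have q_diff: "q n (y - z) = q n y - q n z" for n y z
    by (simp add: q_def algebra_simps)
  have rb: "0 \<le> ?r n" "?r n \<le> 1" "?r n \<le> ?r (Suc n)" for n
    using sqrt_iter_real_bounds[of 1] sqrt_iter_real_Suc_mono[of 1] by auto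
  have qn: "norm (q n y) \<le> ?r n * norm y" for n y
  proof (induction n arbitrary: y)
    case (Suc n)
    have "norm (q n (q n y)) \<le> ?r n * norm (q n y)" by (rule Suc)
    also have "\<dots> \<le> ?r n * (?r n * norm y)" by (intro mult_left_mono Suc rb)
    finally have "norm (q n (q n y)) \<le> (?r n)\<^sup>2 * norm y" by (simp add: power2_eq_square mult.assoc)
    then have "norm ((k *\<^sub>R y - a * y) + q n (q n y)) \<le> norm y + (?r n)\<^sup>2 * norm y"
      using C[of y] by (meson add_mono norm_triangle_ineq order_trans)
    then show ?case unfolding q_Suc norm_scaleR by (simp add: algebra_simps add_divide_distrib)
  qed (simp add: q_def)
  have qd: "norm (q (Suc n) y - q n y) \<le> (?r (Suc n) - ?r n) * norm y" for n y
  proof (induction n arbitrary: y)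
    case 0
    show ?case using C[of y] by (simp add: q_Suc) (simp add: q_def)
  next
    case (Suc n)
    let ?z = "q (Suc n) y - q n y"
    \<comment> \<open>For consecutive iterates \<open>q\<close> and \<open>q'\<close>, the
      difference of squares is \<open>q' (q' - q) + (q' - q) q\<close>. The scalars
      \<open>?r\<close> satisfy the same identity, so the majorization carries over.\<close>
    have eq: "q (Suc (Suc n)) y - q (Suc n) y
        = (1/2) *\<^sub>R (q (Suc n) ?z + (q (Suc n) (q n y) - q n (q n y)))"
      unfolding q_Suc[of "Suc n" y] q_Suc[of n y] q_diff by (simp add: algebra_simps)
    have "norm (q (Suc n) ?z) \<le> ?r (Suc n) * norm ?z" by (rule qn)
    also have "\<dots> \<le> ?r (Suc n) * ((?r (Suc n) - ?r n) * norm y)"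
      by (intro mult_left_mono Suc rb)
    finally have 1: "norm (q (Suc n) ?z) \<le> ?r (Suc n) * (?r (Suc n) - ?r n) * norm y"
      by (simp add: mult.assoc)
    have "norm (q (Suc n) (q n y) - q n (q n y)) \<le> (?r (Suc n) - ?r n) * norm (q n y)"
      by (rule Suc)
    also have "\<dots> \<le> (?r (Suc n) - ?r n) * (?r n * norm y)"
      by (intro mult_left_mono qn) (use rb(3)[of n] in linarith)
    finally have 2: "norm (q (Suc n) (q n y) - q n (q n y)) \<le> (?r (Suc n) - ?r n) * ?r n * norm y"
      by (simp add: mult.assoc)
    have "norm (q (Suc n) ?z + (q (Suc n) (q n y) - q n (q n y)))
        \<le> ?r (Suc n) * (?r (Suc n) - ?r n) * norm y + (?r (Suc n) - ?r n) * ?r n * norm y"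
      using 1 2 by (meson add_mono norm_triangle_ineq order_trans)
    also have "\<dots> = ((?r (Suc n))\<^sup>2 - (?r n)\<^sup>2) * norm y"
      by (simp only: power2_eq_square) (simp only: algebra_simps)
    finally have "norm (q (Suc (Suc n)) y - q (Suc n) y) \<le> ((?r (Suc n))\<^sup>2 - (?r n)\<^sup>2) / 2 * norm y"
      unfolding eq by simp
    also have "((?r (Suc n))\<^sup>2 - (?r n)\<^sup>2) / 2 = ?r (Suc (Suc n)) - ?r (Suc n)"
      unfolding sqrt_iter_real.simps(2)[of 1 "Suc n"] sqrt_iter_real.simps(2)[of 1 n]
      by (simp add: field_simps)
    finally show ?case .
  qed
  have qmn: "norm (q (n + j) y - q n y) \<le> (?r (n + j) - ?r n) * norm y" for n j y
  proof (induction j)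
    case (Suc j)
    have "norm (q (n + Suc j) y - q n y)
        \<le> norm (q (Suc (n + j)) y - q (n + j) y) + norm (q (n + j) y - q n y)"
      using norm_triangle_ineq[of "q (Suc (n + j)) y - q (n + j) y" "q (n + j) y - q n y"] by simp
    also have "\<dots> \<le> (?r (Suc (n + j)) - ?r (n + j)) * norm y + (?r (n + j) - ?r n) * norm y"
      by (intro add_mono qd Suc)
    finally show ?case by (simp add: algebra_simps)
  qed simp
  \<comment> \<open>As operators \<open>?x n = ?m n - q n\<close>, so increments of
    \<open>?x\<close> are controlled by two convergent scalar sequences.\<close>
  have xmn: "norm (?x m - ?x n) \<le> \<bar>?m m - ?m n\<bar> + \<bar>?r m - ?r n\<bar>" for m n
  proof -
    have *: "norm (?x (n + j) - ?x n) \<le> \<bar>?m (n + j) - ?m n\<bar> + \<bar>?r (n + j) - ?r n\<bar>" for n j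
    proof (rule norm_le_of_left_mult)
      fix y
      have "(?x (n + j) - ?x n) * y = (?m (n + j) - ?m n) *\<^sub>R y - (q (n + j) y - q n y)"
        by (simp add: q_def algebra_simps)
      then have "norm ((?x (n + j) - ?x n) * y)
          \<le> \<bar>?m (n + j) - ?m n\<bar> * norm y + norm (q (n + j) y - q n y)"
        by (metis norm_scaleR norm_triangle_ineq4)
      also have "\<dots> \<le> \<bar>?m (n + j) - ?m n\<bar> * norm y + \<bar>?r (n + j) - ?r n\<bar> * norm y"
        using qmn[of n j y] by (smt (verit) mult_right_mono norm_ge_zero)
      finally show "norm ((?x (n + j) - ?x n) * y)
          \<le> (\<bar>?m (n + j) - ?m n\<bar> + \<bar>?r (n + j) - ?r n\<bar>) * norm y"
        by (simp add: algebra_simps)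
    qed simp
    show ?thesis
    proof (cases "n \<le> m")
      case True
      then show ?thesis using *[of n "m - n"] by simp
    next
      case False
      then show ?thesis using *[of m "n - m"] by (simp add: norm_minus_commute abs_minus_commute)
    qed
  qed
  have mt: "?m \<longlonglongrightarrow> 1 - sqrt (1 - k)" by (rule sqrt_iter_real_tendsto[OF k])
  have rt: "?r \<longlonglongrightarrow> 1" using sqrt_iter_real_tendsto[of 1] by simp
  have "Cauchy ?x"
  proof (rule CauchyI)
    fix e :: real assume "0 < e"
    then have e2: "0 < e / 2" by simp
    obtain M where M: "\<And>m n. m \<ge> M \<Longrightarrow> n \<ge> M \<Longrightarrow> norm (?m m - ?m n) < e / 2"
      using CauchyD[OF LIMSEQ_imp_Cauchy[OF mt] e2] by blast
    obtain N where N: "\<And>m n. m \<ge> N \<Longrightarrow> n \<ge> N \<Longrightarrow> norm (?r m - ?r n) < e / 2"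
      using CauchyD[OF LIMSEQ_imp_Cauchy[OF rt] e2] by blast
    show "\<exists>M. \<forall>m\<ge>M. \<forall>n\<ge>M. norm (?x m - ?x n) < e"
    proof (intro exI allI impI)
      fix m n assume "m \<ge> max M N" "n \<ge> max M N"
      then show "norm (?x m - ?x n) < e"
        using M[of m n] N[of m n] xmn[of m n] by simp
    qed
  qed
  then obtain x where x: "?x \<longlonglongrightarrow> x" using Cauchy_convergent convergent_def by blast
  have sx: "star (?x n) = ?x n" for n
    by (induction n) (simp_all add: star_scaleR star_add star_diff star_mult sa)
  have "(\<lambda>n. star (?x n)) \<longlonglongrightarrow> star x" by (rule tendsto_star[OF x])
  then have 1: "star x = x" using x LIMSEQ_unique unfolding sx by blast
  have "(\<lambda>n. ?x (Suc n)) \<longlonglongrightarrow> (1/2) *\<^sub>R (a + (2 * (1 - sqrt (1 - k))) *\<^sub>R x - x * x)"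
    unfolding sqrt_iter.simps by (intro tendsto_intros x mt)
  with LIMSEQ_Suc[OF x] have "x = (1/2) *\<^sub>R (a + (2 * (1 - sqrt (1 - k))) *\<^sub>R x - x * x)"
    using LIMSEQ_unique by blast
  then have "2 *\<^sub>R x = 2 *\<^sub>R ((1/2) *\<^sub>R (a + (2 * (1 - sqrt (1 - k))) *\<^sub>R x - x * x))"
    by (rule arg_cong)
  then have 2: "(2 * sqrt (1 - k)) *\<^sub>R x + x * x = a"
    by (simp add: algebra_simps)
  have 3: "norm ((1 - sqrt (1 - k)) *\<^sub>R y - x * y) \<le> norm y" for y
  proof -
    have "(\<lambda>n. norm (q n y)) \<longlonglongrightarrow> norm ((1 - sqrt (1 - k)) *\<^sub>R y - x * y)"
      unfolding q_def by (intro tendsto_intros x mt)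
    moreover have "norm (q n y) \<le> norm y" for n
      using qn[of n y] mult_right_mono[OF rb(2)[of n], of "norm y"] by simp
    ultimately show ?thesis using LIMSEQ_le_const2 by blast
  qed
  have 4: "w * x = x * w" if w: "w * a = a * w" for w
  proof -
    have c: "w * ?x n = ?x n * w" for n
    proof (induction n)
      case (Suc n)
      have "w * (?x n * ?x n) = ?x n * ?x n * w" by (metis Suc mult.assoc)
      then show ?case by (simp add: algebra_simps w Suc)
    qed simp
    have "(\<lambda>n. w * ?x n) \<longlonglongrightarrow> w * x" "(\<lambda>n. ?x n * w) \<longlonglongrightarrow> x * w"
      by (intro tendsto_intros x)+
    then show ?thesis using LIMSEQ_unique unfolding c by blast
  qed
  show ?thesis by (rule that[OF 1 2 3 4])
qed

text \<open>
  \<open>upos l a\<close> says that \<open>l + a\<close> is positive in the unitization, which is never constructed: its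
  elements act on the algebra by left multiplication, and \<open>T\<close> is positive iff \<open>\<parallel>s - T\<parallel> \<le> s\<close> for some
  \<open>s > 0\<close>.
\<close>

definition upos :: "real \<Rightarrow> 'a::cstar_algebra \<Rightarrow> bool" where
  "upos l a \<longleftrightarrow> star a = a \<and> (\<exists>s>0. \<forall>y. norm ((s - l) *\<^sub>R y - a * y) \<le> s * norm y)"

abbreviation psd :: "'a::cstar_algebra \<Rightarrow> bool" where
  "psd \<equiv> upos 0"

text \<open>The operator changes by the scalar \<open>t - s \<ge> 0\<close>. Hence a witness
  \<open>s\<close> in \<open>upos\<close> may be enlarged freely.\<close>

lemma upos_bound_mono:
  fixes y :: "'a::cstar_algebra"
  assumes "norm ((s - l) *\<^sub>R y - a * y) \<le> s * norm y" "s \<le> t"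
  shows "norm ((t - l) *\<^sub>R y - a * y) \<le> t * norm y"
proof -
  have "(t - l) *\<^sub>R y - a * y = (t - s) *\<^sub>R y + ((s - l) *\<^sub>R y - a * y)"
    by (simp add: algebra_simps)
  then have "norm ((t - l) *\<^sub>R y - a * y) \<le> \<bar>t - s\<bar> * norm y + norm ((s - l) *\<^sub>R y - a * y)"
    by (metis norm_scaleR norm_triangle_ineq)
  also have "\<dots> \<le> (t - s) * norm y + s * norm y"
    using assms by simp
  finally show ?thesis by (simp add: algebra_simps)
qed

lemma upos_add:
  assumes "upos l a" "upos m b"
  shows "upos (l + m) (a + b)"
proof -
  obtain s t where s: "0 < s" "\<And>y. norm ((s - l) *\<^sub>R y - a * y) \<le> s * norm y"
    and t: "0 < t" "\<And>y. norm ((t - m) *\<^sub>R y - b * y) \<le> t * norm y"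
    using assms unfolding upos_def by blast
  have "norm ((s + t - (l + m)) *\<^sub>R y - (a + b) * y) \<le> (s + t) * norm y" for y
  proof -
    have "(s + t - (l + m)) *\<^sub>R y - (a + b) * y
        = ((s - l) *\<^sub>R y - a * y) + ((t - m) *\<^sub>R y - b * y)"
      by (simp add: algebra_simps)
    then have "norm ((s + t - (l + m)) *\<^sub>R y - (a + b) * y)
        \<le> norm ((s - l) *\<^sub>R y - a * y) + norm ((t - m) *\<^sub>R y - b * y)"
      by (metis norm_triangle_ineq)
    then show ?thesis using s(2)[of y] t(2)[of y] by (simp add: algebra_simps)
  qed
  then show ?thesis using s t assms unfolding upos_def star_add by (metis add_pos_pos)
qed

text \<open>Dividing \<open>l + a\<close> by \<open>s\<close> gives \<open>1 - (k - a / s)\<close>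
  with \<open>k = 1 - l / s\<close>, which is the normalized case; the resulting root is multiplied
  back by \<open>sqrt s\<close>.\<close>

lemma upos_sqrt:
  fixes a :: "'a::cstar_algebra"
  assumes "upos l a" "0 \<le> l"
  obtains x where "upos (sqrt l) x" "(2 * sqrt l) *\<^sub>R x + x * x = a"
    "\<And>w. w * a = a * w \<Longrightarrow> w * x = x * w"
proof -
  obtain s0 where s0: "0 < s0" "\<And>y. norm ((s0 - l) *\<^sub>R y - a * y) \<le> s0 * norm y"
    using assms unfolding upos_def by blast
  \<comment> \<open>The maximum with \<open>l\<close> ensures \<open>0 \<le> k\<close>.\<close>
  define s where "s = max s0 l"
  have s: "0 < s" "l \<le> s" "\<And>y. norm ((s - l) *\<^sub>R y - a * y) \<le> s * norm y"
    using s0(1) upos_bound_mono[OF s0(2), of s] by (auto simp: s_def less_max_iff_disj)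
  define k where "k = 1 - l / s"
  have k: "0 \<le> k" "k \<le> 1" using s assms by (auto simp: k_def)
  have sq: "sqrt (1 - k) = sqrt l / sqrt s" by (simp add: k_def real_sqrt_divide)
  have ss: "sqrt s * sqrt s = s" "sqrt s > 0" using s by auto
  have "norm (k *\<^sub>R y - ((1 / s) *\<^sub>R a) * y) \<le> norm y" for y
  proof -
    have "k *\<^sub>R y - ((1 / s) *\<^sub>R a) * y = (1 / s) *\<^sub>R ((s - l) *\<^sub>R y - a * y)"
      using s by (simp add: k_def algebra_simps diff_divide_distrib)
    then have "norm (k *\<^sub>R y - ((1 / s) *\<^sub>R a) * y) = norm ((s - l) *\<^sub>R y - a * y) / s"
      using s by simp
    then show ?thesis using s by (simp add: pos_divide_le_eq mult.commute)
  qed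
  moreover have "star ((1 / s) *\<^sub>R a) = (1 / s) *\<^sub>R a"
    using assms by (simp add: upos_def star_scaleR)
  ultimately obtain x where x: "star x = x" "(2 * sqrt (1 - k)) *\<^sub>R x + x * x = (1 / s) *\<^sub>R a"
    "\<And>y. norm ((1 - sqrt (1 - k)) *\<^sub>R y - x * y) \<le> norm y"
    "\<And>w. w * ((1 / s) *\<^sub>R a) = ((1 / s) *\<^sub>R a) * w \<Longrightarrow> w * x = x * w"
    using unit_sqrt_exists[OF _ k] by metis
  have "norm ((sqrt s - sqrt l) *\<^sub>R y - (sqrt s *\<^sub>R x) * y) \<le> sqrt s * norm y" for y
  proof -
    have "(sqrt s - sqrt l) *\<^sub>R y - (sqrt s *\<^sub>R x) * y
        = sqrt s *\<^sub>R ((1 - sqrt (1 - k)) *\<^sub>R y - x * y)"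
      using ss by (simp add: sq algebra_simps)
    then have "norm ((sqrt s - sqrt l) *\<^sub>R y - (sqrt s *\<^sub>R x) * y)
        = sqrt s * norm ((1 - sqrt (1 - k)) *\<^sub>R y - x * y)"
      using ss by simp
    then show ?thesis using x(3)[of y] ss by simp
  qed
  then have 1: "upos (sqrt l) (sqrt s *\<^sub>R x)"
    using x(1) ss(2) unfolding upos_def by (metis star_scaleR)
  have "(2 * sqrt l) *\<^sub>R (sqrt s *\<^sub>R x) + (sqrt s *\<^sub>R x) * (sqrt s *\<^sub>R x)
      = s *\<^sub>R ((2 * sqrt (1 - k)) *\<^sub>R x + x * x)"
  proof -
    have "s * (2 * (sqrt l / sqrt s)) = 2 * sqrt l * sqrt s"
      using ss by (simp add: field_simps)
    then show ?thesis using ss by (simp add: sq scaleR_add_right)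
  qed
  then have 2: "(2 * sqrt l) *\<^sub>R (sqrt s *\<^sub>R x) + (sqrt s *\<^sub>R x) * (sqrt s *\<^sub>R x) = a"
    using s by (simp add: x(2))
  have 3: "w * (sqrt s *\<^sub>R x) = (sqrt s *\<^sub>R x) * w" if "w * a = a * w" for w
    using x(4)[of w] that by simp
  show ?thesis by (rule that[OF 1 2 3])
qed

section \<open>The positive cone\<close>

lemma scaleC_minus_right: "c *\<^sub>C (- x) = - (c *\<^sub>C (x::'a::cstar_algebra))"
  using scaleC_scaleC[of c "complex_of_real (-1)" x] scaleC_scaleC[of "complex_of_real (-1)" c x]
  by (simp only: scaleC_of_real mult.commute) simp

lemma scaleC_minus_left: "(- c) *\<^sub>C x = - (c *\<^sub>C (x::'a::cstar_algebra))"
  using scaleC_scaleC[of "complex_of_real (-1)" c x] by (simp only: scaleC_of_real) simp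

lemma scaleC_diff_right: "c *\<^sub>C (x - y) = c *\<^sub>C x - c *\<^sub>C (y::'a::cstar_algebra)"
  using scaleC_add_right[of c x "- y"] by (simp add: scaleC_minus_right)

lemma scaleC_ii_ii: "\<i> *\<^sub>C \<i> *\<^sub>C x = - (x::'a::cstar_algebra)"
  using scaleC_of_real[of "-1" x] by (simp add: scaleC_scaleC)

text \<open>The hypothesis says \<open>h\<^sup>2 + (r + x)\<^sup>2 = r\<^sup>2\<close>, so \<open>h \<plusminus> \<i> (r + x)\<close> are \<open>r\<close> times unitaries.\<close>

lemma unitary_real_part_bound:
  fixes h x :: "'a::cstar_algebra"
  assumes h: "star h = h" and x: "star x = x" and comm: "h * x = x * h"
    and eq: "h * h + (2 * r) *\<^sub>R x + x * x = 0" and r: "0 \<le> r"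
  shows "norm (h * y) \<le> r * norm y" and "norm (r *\<^sub>R y + x * y) \<le> r * norm y"
proof -
  \<comment> \<open>Here \<open>z\<close> is \<open>(r + x) y\<close>, and \<open>w\<close>,
    \<open>v\<close> are the images of \<open>y\<close> under the two multiples of unitaries. Both
    turn out to have norm \<open>r * norm y\<close>.\<close>
  define z where "z = r *\<^sub>R y + x * y"
  define w where "w = h * y + \<i> *\<^sub>C z"
  define v where "v = h * y - \<i> *\<^sub>C z"
  have sz: "star z = r *\<^sub>R star y + star y * x"
    by (simp add: z_def star_add star_scaleR star_mult x)
  have "star y * h * z = r *\<^sub>R (star y * h * y) + star y * (h * x) * y"
    by (simp add: z_def distrib_left distrib_right mult.assoc)
  moreover have "star z * h * y = r *\<^sub>R (star y * h * y) + star y * (x * h) * y"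
    by (simp add: sz distrib_left distrib_right mult.assoc)
  ultimately have cross: "star y * h * z = star z * h * y" by (simp only: comm)
  have "star y * h * (h * y) + star z * z
      = star y * (h * h + (2 * r) *\<^sub>R x + x * x) * y + (r * r) *\<^sub>R (star y * y)"
    unfolding sz unfolding z_def by (simp add: algebra_simps) (simp flip: scaleR_add_left)
  then have sq: "star y * h * (h * y) + star z * z = (r * r) *\<^sub>R (star y * y)"
    by (simp add: eq)
  have "star w * w = star y * h * (h * y) + star z * z
      + \<i> *\<^sub>C (star y * h * z) - \<i> *\<^sub>C (star z * h * y)"
    by (simp add: w_def star_add star_mult star_scaleC h algebra_simps mult_scaleC_left
        mult_scaleC_right scaleC_minus_left scaleC_add_right scaleC_diff_right scaleC_ii_ii)
  then have "star w * w = (r * r) *\<^sub>R (star y * y)"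
    by (simp add: cross sq)
  then have "(norm w)\<^sup>2 = (r * norm y)\<^sup>2"
    using cstar_identity[of w] cstar_identity[of y] by (simp add: power2_eq_square ac_simps)
  then have w: "norm w = r * norm y" using r by simp
  have "star v * v = star y * h * (h * y) + star z * z
      - \<i> *\<^sub>C (star y * h * z) + \<i> *\<^sub>C (star z * h * y)"
    by (simp add: v_def star_diff star_mult star_scaleC h algebra_simps mult_scaleC_left
        mult_scaleC_right scaleC_minus_left scaleC_add_right scaleC_diff_right scaleC_ii_ii)
  then have "star v * v = (r * r) *\<^sub>R (star y * y)"
    by (simp add: cross sq)
  then have "(norm v)\<^sup>2 = (r * norm y)\<^sup>2"
    using cstar_identity[of v] cstar_identity[of y] by (simp add: power2_eq_square ac_simps)
  then have v: "norm v = r * norm y" using r by simp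
  have "2 *\<^sub>R (h * y) = w + v" by (simp add: w_def v_def scaleR_2)
  then have "2 * norm (h * y) \<le> norm w + norm v"
    by (metis norm_scaleR norm_triangle_ineq abs_numeral)
  then show "norm (h * y) \<le> r * norm y" using w v by simp
  have "2 *\<^sub>R (\<i> *\<^sub>C z) = w - v" by (simp add: w_def v_def scaleR_2)
  then have "2 * norm (\<i> *\<^sub>C z) \<le> norm w + norm v"
    by (metis norm_scaleR norm_triangle_ineq4 abs_numeral)
  then show "norm (r *\<^sub>R y + x * y) \<le> r * norm y" using w v by (simp add: norm_scaleC z_def)
qed

lemma norm_mult_mult_le:
  fixes b :: "'a::cstar_algebra"
  assumes "norm b \<le> r"
  shows "norm (b * b * y) \<le> r\<^sup>2 * norm y"
proof -
  have "norm (b * b * y) \<le> norm b * (norm b * norm y)"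
    by (metis mult.assoc mult_left_mono norm_ge_zero norm_mult_ineq order_trans)
  also have "\<dots> = (norm b)\<^sup>2 * norm y" by (simp add: power2_eq_square)
  also have "\<dots> \<le> r\<^sup>2 * norm y" using assms by (simp add: mult_right_mono power_mono)
  finally show ?thesis .
qed

text \<open>In the unitization \<open>r\<^sup>2 - b\<^sup>2\<close> has a root \<open>r + x\<close>
  commuting with \<open>b\<close>. Then \<open>b\<close> and \<open>r + x\<close> are real and
  imaginary part of \<open>r\<close> times a unitary, so \<open>r + x\<close> has norm at most
  \<open>r\<close>, and its square at most \<open>r\<^sup>2\<close>.\<close>

lemma square_bound:
  fixes b :: "'a::cstar_algebra"
  assumes b: "star b = b" and r: "norm b \<le> r" "0 < r"
  shows "norm (r\<^sup>2 *\<^sub>R y - b * b * y) \<le> r\<^sup>2 * norm y"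
proof -
  have "upos (r\<^sup>2) (- (b * b))"
    unfolding upos_def
  proof (intro conjI exI allI)
    show "norm ((r\<^sup>2 - r\<^sup>2) *\<^sub>R y - - (b * b) * y) \<le> r\<^sup>2 * norm y" for y
      using norm_mult_mult_le[OF r(1)] by simp
  qed (use r b in \<open>simp_all add: star_minus star_mult\<close>)
  then obtain x where "upos (sqrt (r\<^sup>2)) x" "(2 * sqrt (r\<^sup>2)) *\<^sub>R x + x * x = - (b * b)"
    "\<And>w. w * (- (b * b)) = (- (b * b)) * w \<Longrightarrow> w * x = x * w"
    using upos_sqrt by (metis zero_le_power2)
  then have x: "star x = x" "b * b + (2 * r) *\<^sub>R x + x * x = 0" "b * x = x * b"
    using r by (auto simp: upos_def mult.assoc add.assoc)
  note bd = unitary_real_part_bound(2)[OF b x(1) x(3) x(2)]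
  have "r\<^sup>2 *\<^sub>R y - b * b * y = r *\<^sub>R (r *\<^sub>R y + x * y) + x * (r *\<^sub>R y + x * y)"
  proof -
    have "r *\<^sub>R (r *\<^sub>R y + x * y) + x * (r *\<^sub>R y + x * y)
        = r\<^sup>2 *\<^sub>R y - b * b * y + (b * b + (2 * r) *\<^sub>R x + x * x) * y"
      by (simp add: algebra_simps power2_eq_square) (simp flip: scaleR_add_left)
    then show ?thesis by (simp add: x(2))
  qed
  then have "norm (r\<^sup>2 *\<^sub>R y - b * b * y) \<le> r * norm (r *\<^sub>R y + x * y)"
    using bd[of "r *\<^sub>R y + x * y"] r by simp
  also have "\<dots> \<le> r * (r * norm y)" using bd[of y] r by simp
  finally show ?thesis by (simp add: power2_eq_square)
qed

lemma psd_square: "star b = b \<Longrightarrow> psd (b * b)"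
proof -
  assume b: "star b = b"
  \<comment> \<open>Adding 1 keeps the witness positive when \<open>b = 0\<close>.\<close>
  have "norm ((norm b + 1)\<^sup>2 *\<^sub>R y - b * b * y) \<le> (norm b + 1)\<^sup>2 * norm y" for y
    by (rule square_bound[OF b]) (simp_all add: add_nonneg_pos)
  moreover have "(norm b + 1)\<^sup>2 > 0" by (smt (verit) norm_ge_zero zero_less_power)
  ultimately show ?thesis unfolding upos_def using b by (metis diff_zero star_mult)
qed

lemma psd_star: "psd a \<Longrightarrow> star a = a"
  by (simp add: upos_def)

lemma psd_sqrt:
  assumes "psd a"
  obtains h where "psd h" "h * h = a" "\<And>w. w * a = a * w \<Longrightarrow> w * h = h * w"
proof -
  obtain x where x: "upos (sqrt 0) x" "(2 * sqrt 0) *\<^sub>R x + x * x = a"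
    "\<And>w. w * a = a * w \<Longrightarrow> w * x = x * w"
    using upos_sqrt[OF assms order_refl] by blast
  have "psd x" "x * x = a" using x(1,2) by simp_all
  then show ?thesis using x(3) by (rule that)
qed

lemma psd_add: "psd a \<Longrightarrow> psd b \<Longrightarrow> psd (a + b)"
  using upos_add[of 0 a 0 b] by simp

lemma psd_zero [simp]: "psd (0::'a::cstar_algebra)"
  using psd_square[of "0::'a"] by simp

text \<open>Since \<open>a\<close> is the square of a self-adjoint element of norm at most
  \<open>sqrt s\<close>, \<open>square_bound\<close> applies. The witness now depends only on a norm
  bound, which is what passing to limits requires.\<close>

lemma psd_bound:
  assumes "psd a" "norm a \<le> s" "0 < s"
  shows "norm (s *\<^sub>R y - a * y) \<le> s * norm y"
proof -
  obtain h where h: "psd h" "h * h = a" using psd_sqrt[OF assms(1)] by blast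
  have "(norm h)\<^sup>2 \<le> s" using cstar_identity[of h] h psd_star[of h] assms by simp
  then have "norm h \<le> sqrt s" by (simp add: real_le_rsqrt)
  then show ?thesis using square_bound[OF psd_star[OF h(1)], of "sqrt s" y] h assms by simp
qed

text \<open>For \<open>t \<ge> norm b\<close> the sum of \<open>t - b\<close> and
  \<open>b - a\<close> is positive, so \<open>t - a\<close> has a root \<open>sqrt t + x\<close>.
  With \<open>h\<close> the root of \<open>a\<close>, the squares of \<open>h\<close> and
  \<open>sqrt t + x\<close> add up to \<open>t\<close>, whence
  \<open>norm h \<le> sqrt t\<close>.\<close>

lemma psd_norm_mono:
  assumes a: "psd a" and ba: "psd (b - a)"
  shows "norm a \<le> norm b"
proof -
  have b: "psd b" using psd_add[OF a ba] by simp
  have *: "norm a \<le> t" if t: "norm b \<le> t" "0 < t" for t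
  proof -
    have "upos t (- b)"
      unfolding upos_def
    proof (intro conjI exI allI)
      show "norm ((t - t) *\<^sub>R y - - b * y) \<le> t * norm y" for y
        using norm_mult_ineq[of b y] t mult_right_mono[OF t(1), of "norm y"] by simp
    qed (use t psd_star[OF b] in \<open>simp_all add: star_minus\<close>)
    from upos_add[OF this ba] have "upos t (- a)" by simp
    then obtain x where x: "upos (sqrt t) x" "(2 * sqrt t) *\<^sub>R x + x * x = - a"
      "\<And>w. w * (- a) = (- a) * w \<Longrightarrow> w * x = x * w"
      using upos_sqrt t by (metis less_imp_le)
    obtain h where h: "psd h" "h * h = a" "\<And>w. w * a = a * w \<Longrightarrow> w * h = h * w"
      using psd_sqrt[OF a] by blast
    have "a * x = x * a" using x(3)[of a] by simp
    then have "h * x = x * h" using h(3)[of x] by simp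
    moreover have "h * h + (2 * sqrt t) *\<^sub>R x + x * x = 0"
      using x(2) h(2) by (simp add: add.assoc)
    moreover have "star x = x" using x(1) by (simp add: upos_def)
    ultimately have "norm (h * y) \<le> sqrt t * norm y" for y
      using unitary_real_part_bound(1) psd_star[OF h(1)] t by (metis less_imp_le real_sqrt_ge_zero)
    then have "norm h \<le> sqrt t" using norm_le_of_left_mult t by (metis less_imp_le real_sqrt_ge_zero)
    then have "(norm h)\<^sup>2 \<le> t" using t by (metis norm_ge_zero real_sqrt_pow2_iff power_mono less_imp_le)
    then show ?thesis using cstar_identity[of h] h(2) psd_star[OF h(1)] by simp
  qed
  show ?thesis
    by (rule field_le_epsilon) (use * in \<open>simp add: add_nonneg_pos\<close>)
qed

lemma psd_antisym: "psd a \<Longrightarrow> psd (- a) \<Longrightarrow> a = 0"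
  using psd_norm_mono[of a 0] by simp

lemma psd_scaleR: "psd a \<Longrightarrow> 0 \<le> r \<Longrightarrow> psd (r *\<^sub>R a)"
proof -
  assume a: "psd a" and r: "0 \<le> r"
  obtain h where h: "psd h" "h * h = a" using psd_sqrt[OF a] by blast
  have "psd ((sqrt r *\<^sub>R h) * (sqrt r *\<^sub>R h))"
    by (rule psd_square) (simp add: star_scaleR psd_star h)
  then show ?thesis using h r by simp
qed

lemma psd_limit:
  assumes "\<And>n. psd (f n)" "f \<longlonglongrightarrow> a"
  shows "psd a"
proof -
  obtain K where K: "K > 0" "\<And>n. norm (f n) \<le> K"
    using Bseq_def convergent_imp_Bseq convergentI assms(2) by metis
  have "(\<lambda>n. star (f n)) \<longlonglongrightarrow> star a" by (rule tendsto_star[OF assms(2)])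
  then have sa: "star a = a"
    using assms(2) LIMSEQ_unique psd_star[OF assms(1)] by auto
  have "norm (K *\<^sub>R y - a * y) \<le> K * norm y" for y
  proof -
    have "(\<lambda>n. norm (K *\<^sub>R y - f n * y)) \<longlonglongrightarrow> norm (K *\<^sub>R y - a * y)"
      by (intro tendsto_intros assms(2))
    moreover have "norm (K *\<^sub>R y - f n * y) \<le> K * norm y" for n
      using psd_bound[OF assms(1) K(2) K(1)] .
    ultimately show ?thesis using LIMSEQ_le_const2 by blast
  qed
  then show ?thesis unfolding upos_def using sa K by (metis diff_zero)
qed

text \<open>Up to sign, \<open>p\<close> and \<open>q\<close> are twice the real and imaginary parts
  of \<open>w\<close>; their squares add up to twice the element in question.\<close>

lemma psd_star_mult_add_mult_star: "psd (w * star w + star w * w)"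
proof -
  define p q where "p = w + star w" and "q = \<i> *\<^sub>C (w - star w)"
  have "star p = p" by (simp add: p_def star_add star_star add.commute)
  moreover have "star q = q"
    by (simp add: q_def star_scaleC star_diff star_star scaleC_minus_left flip: scaleC_minus_right)
  ultimately have "psd (p * p + q * q)" by (intro psd_add psd_square)
  moreover have "p * p + q * q = 2 *\<^sub>R (w * star w + star w * w)"
    by (simp add: p_def q_def mult_scaleC_left mult_scaleC_right scaleC_ii_ii)
      (simp add: algebra_simps scaleR_2)
  ultimately show ?thesis using psd_scaleR[of "p * p + q * q" "1/2"] by simp
qed

text \<open>Negativity of \<open>star w * w\<close> makes \<open>w * star w\<close> a positive
  square \<open>k * k\<close>. For \<open>w * c\<close> both products are negatives of fourth
  powers, yet their sum is positive; this forces \<open>k\<^sup>4 = 0\<close>.\<close>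

lemma star_mult_self_eq_minus_square:
  assumes w: "star w * w = - (c * c)" and c: "star c = c"
  shows "w = 0"
proof -
  have "psd (w * star w + star w * w + c * c)"
    by (intro psd_add psd_star_mult_add_mult_star psd_square c)
  then have ww: "psd (w * star w)" by (simp add: w)
  obtain k where k: "psd k" "k * k = w * star w" using psd_sqrt[OF ww] by blast
  have sk: "star (k * k) = k * k" by (simp add: star_mult psd_star[OF k(1)])
  have sc: "star (c * c) = c * c" by (simp add: star_mult c)
  have "(w * c) * star (w * c) = - ((k * k) * (k * k))"
  proof -
    have "(w * c) * star (w * c) = w * (c * c) * star w" by (simp add: star_mult c mult.assoc)
    also have "c * c = - (star w * w)" by (simp add: w)
    finally show ?thesis by (simp add: k mult.assoc)
  qed
  moreover have "star (w * c) * (w * c) = - ((c * c) * (c * c))"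
  proof -
    have "star (w * c) * (w * c) = c * (star w * w) * c" by (simp add: star_mult c mult.assoc)
    then show ?thesis by (simp add: w mult.assoc)
  qed
  ultimately have "psd (- ((k * k) * (k * k)) + - ((c * c) * (c * c)))"
    using psd_star_mult_add_mult_star[of "w * c"] by simp
  from psd_add[OF this psd_square[OF sc]] have "psd (- ((k * k) * (k * k)))" by simp
  with psd_square[OF sk] have "(k * k) * (k * k) = 0" by (rule psd_antisym)
  then have "k * k = 0" using star_mult_self_eq_0[of "k * k"] sk by simp
  then show ?thesis using k star_mult_self_eq_0[of "star w"]
    by (simp add: star_star) (metis star_star star_zero)
qed

text \<open>With \<open>g\<close> the absolute value of \<open>h\<close>, the element
  \<open>e = g - h\<close> satisfies \<open>e * h * e = - (e * g * e)\<close>. The left side is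
  \<open>star (z * e) * (z * e)\<close> and the right side minus a square, so
  \<open>z * e = 0\<close>; then \<open>e\<^sup>3 = 0\<close> and \<open>e = 0\<close>, that is,
  \<open>h = g\<close>.\<close>

lemma psd_star_mult_self: "psd (star z * z)"
proof -
  define h where "h = star z * z"
  have sh: "star h = h" by (simp add: h_def star_mult star_star)
  obtain g where g: "psd g" "g * g = h * h" "\<And>w. w * (h * h) = (h * h) * w \<Longrightarrow> w * g = g * w"
    using psd_sqrt[OF psd_square[OF sh]] by blast
  have hg: "h * g = g * h" by (rule g(3)) (simp add: mult.assoc)
  obtain p where p: "psd p" "p * p = g" "\<And>w. w * g = g * w \<Longrightarrow> w * p = p * w"
    using psd_sqrt[OF g(1)] by blast
  \<comment> \<open>\<open>e\<close> is twice the negative part of \<open>h\<close>\<close>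
  define e where "e = g - h"
  have se: "star e = e" by (simp add: e_def star_diff sh psd_star[OF g(1)])
  have eg: "e * g = g * e" by (simp add: e_def algebra_simps hg)
  have ep: "e * p = p * e" by (rule p(3)[OF eg])
  have ge: "g * e = - (h * e)" by (simp add: e_def algebra_simps g(2) hg)
  define c where "c = p * e"
  have sc: "star c = c" by (simp add: c_def star_mult se psd_star[OF p(1)] ep)
  have "c * c = (e * p) * (p * e)" by (simp only: c_def ep)
  then have cc: "c * c = e * g * e" by (simp only: p(2)[symmetric] mult.assoc)
  have "star (z * e) * (z * e) = e * h * e" by (simp add: star_mult se h_def mult.assoc)
  also have ehe: "\<dots> = - (c * c)" by (simp add: cc mult.assoc ge)
  finally have "z * e = 0" using sc by (rule star_mult_self_eq_minus_square)
  then have "e * h * e = 0" by (simp add: h_def mult.assoc)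
  moreover from this have "e * g * e = 0" using ehe cc by simp
  moreover have "e * (g - h) * e = e * g * e - e * h * e"
    by (simp add: left_diff_distrib right_diff_distrib)
  ultimately have "e * e * e = 0" by (simp flip: e_def)
  then have "star (e * e) * (e * e) = 0" by (simp add: star_mult se mult.assoc[symmetric])
  then have "star e * e = 0" by (simp add: star_mult_self_eq_0 se)
  then have "e = 0" by (simp add: star_mult_self_eq_0)
  then show ?thesis using g(1) by (simp add: e_def h_def)
qed

lemma cstar_pos_UNIV_iff: "a \<in> cstar_pos UNIV \<longleftrightarrow> psd a"
proof
  assume "psd a"
  then obtain h where "psd h" "h * h = a" using psd_sqrt by blast
  then have "a = star h * h" by (simp add: psd_star)
  then show "a \<in> cstar_pos UNIV" unfolding cstar_pos_def by blast
qed (auto simp: cstar_pos_def psd_star_mult_self)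

lemma psd_mult_star_self: "psd (z * star z)"
  using psd_star_mult_self[of "star z"] by (simp add: star_star)

text \<open>Right multiplication by the element \<open>l - u\<close> of the unitization.\<close>

lemma norm_diff_mult_mono:
  fixes a b u :: "'a::cstar_algebra"
  assumes "psd (star b * b - star a * a)"
  shows "norm (l *\<^sub>R a - a * u) \<le> norm (l *\<^sub>R b - b * u)"
proof -
  obtain k where k: "psd k" "k * k = star b * b - star a * a" using psd_sqrt[OF assms] by blast
  \<comment> \<open>\<open>F K\<close> is \<open>(l - star u) K (l - u)\<close> multiplied out
    inside the algebra; it is additive in \<open>K\<close> and sends squares of self-adjoint
    elements to positive ones.\<close>
  define F where "F K = (l * l) *\<^sub>R K - l *\<^sub>R (K * u) - l *\<^sub>R (star u * K) + star u * K * u" for K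
  have F: "star (l *\<^sub>R c - c * u) * (l *\<^sub>R c - c * u) = F (star c * c)" for c
    by (simp add: F_def star_diff star_scaleR star_mult algebra_simps)
  have "F (star b * b) - F (star a * a) = F (k * k)"
    unfolding k(2) by (simp add: F_def algebra_simps)
  also have "\<dots> = star (l *\<^sub>R k - k * u) * (l *\<^sub>R k - k * u)"
    using F[of k] by (simp add: psd_star[OF k(1)])
  finally have "psd (F (star b * b) - F (star a * a))" by (simp add: psd_star_mult_self)
  then have "norm (star (l *\<^sub>R a - a * u) * (l *\<^sub>R a - a * u))
      \<le> norm (star (l *\<^sub>R b - b * u) * (l *\<^sub>R b - b * u))"
    by (intro psd_norm_mono psd_star_mult_self) (simp add: F)
  then show ?thesis by (simp add: cstar_identity)
qed

lemma norm_mult_mono: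
  fixes a b u :: "'a::cstar_algebra"
  assumes "psd (star b * b - star a * a)"
  shows "norm (a * u) \<le> norm (b * u)"
  using norm_diff_mult_mono[OF assms, of 0 u] by simp

text \<open>The element \<open>u\<close> is \<open>h (e + h)\<^sup>-\<^sup>1\<close>, found as the fixed point of a contraction.\<close>

lemma resolvent:
  fixes h :: "'a::cstar_algebra"
  assumes h: "psd h" and e: "0 < e"
  obtains u where "star u = u" "e *\<^sub>R u = h - h * u" "u * h = h * u" "norm u \<le> 2"
    "\<And>y. norm (y - u * y) \<le> norm y"
proof -
  obtain s where s: "0 < s" "\<And>y. norm (s *\<^sub>R y - h * y) \<le> s * norm y"
    using h unfolding upos_def by auto
  \<comment> \<open>Fixed points of \<open>f\<close> are the solutions of
    \<open>e u = h - h u\<close>; the factor \<open>s / (s + e)\<close> comes from the positivity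
    bound on \<open>s - h\<close>.\<close>
  define f where "f u = (1 / (s + e)) *\<^sub>R (s *\<^sub>R u - h * u + h)" for u
  have "\<exists>!u\<in>UNIV. f u = u"
  proof (rule Banach_fix[where c = "s / (s + e)"])
    show "dist (f x) (f y) \<le> s / (s + e) * dist x y" for x y
    proof -
      have "f x - f y = (1 / (s + e)) *\<^sub>R (s *\<^sub>R (x - y) - h * (x - y))"
        by (simp add: f_def algebra_simps)
      then have "norm (f x - f y) = norm (s *\<^sub>R (x - y) - h * (x - y)) / (s + e)"
        using s e by simp
      also have "\<dots> \<le> s * norm (x - y) / (s + e)"
        using s e by (intro divide_right_mono) auto
      finally show "dist (f x) (f y) \<le> s / (s + e) * dist x y" by (simp add: dist_norm)
    qed
  qed (use s e in \<open>simp_all add: complete_UNIV\<close>)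
  then obtain u where "f u = u" by blast
  then have "(s + e) *\<^sub>R u = (s + e) *\<^sub>R f u" by simp
  also have "\<dots> = s *\<^sub>R u - h * u + h" using s e by (simp add: f_def)
  finally have eq: "e *\<^sub>R u = h - h * u" by (simp add: algebra_simps)
  have "star (e *\<^sub>R u) = star (h - h * u)" by (rule arg_cong[OF eq])
  then have eq': "e *\<^sub>R star u = h - star u * h"
    by (simp add: star_scaleR star_diff star_mult psd_star[OF h])
  \<comment> \<open>By the equation and its adjoint the two sides are \<open>star u * h\<close> and
    \<open>h * u\<close>.\<close>
  have "star u * (e *\<^sub>R u + h * u) = (e *\<^sub>R star u + star u * h) * u"
    by (simp add: algebra_simps)
  then have "star u * h = h * u" using eq eq' by simp
  then have "e *\<^sub>R star u = e *\<^sub>R u" using eq eq' by simp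
  then have su: "star u = u" using e by simp
  \<comment> \<open>\<open>1 - u\<close> is \<open>e (e + h)\<^sup>-\<^sup>1\<close>, a contraction
    because \<open>h\<close> is positive.\<close>
  have contr: "norm (y - u * y) \<le> norm y" for y
  proof -
    define z where "z = y - u * y"
    have "e *\<^sub>R (u * y) = h * y - h * (u * y)"
      using arg_cong[OF eq, of "\<lambda>v. v * y"] by (simp add: algebra_simps)
    then have "(s + e) *\<^sub>R z = e *\<^sub>R y + (s *\<^sub>R z - h * z)"
      by (simp add: z_def algebra_simps)
    then have "norm ((s + e) *\<^sub>R z) \<le> norm (e *\<^sub>R y) + norm (s *\<^sub>R z - h * z)"
      by (metis norm_triangle_ineq)
    then have "(s + e) * norm z \<le> e * norm y + s * norm z" using s(1) s(2)[of z] e by simp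
    then have "e * norm z \<le> e * norm y" by (simp add: distrib_right)
    then show ?thesis using e by (simp add: z_def)
  qed
  have "norm (u * y) \<le> 2 * norm y" for y
    using contr[of y] norm_triangle_ineq4[of y "y - u * y"] by simp
  then have "norm u \<le> 2" by (rule norm_le_of_left_mult) simp
  then show ?thesis using that[OF su eq _ _ contr] \<open>star u * h = h * u\<close> su by simp
qed

section \<open>Sums and series of positive elements\<close>

lemma psd_sum: "(\<And>i. i \<in> A \<Longrightarrow> psd (f i)) \<Longrightarrow> psd (sum f A)"
  by (induction A rule: infinite_finite_induct) (auto intro: psd_add)

lemma psd_sums_diff:
  assumes "f sums S" "\<And>i. psd (f i)"
  shows "psd (S - sum f {..<N})"
proof (rule psd_limit)
  show "(\<lambda>n. sum f {..<n + N} - sum f {..<N}) \<longlonglongrightarrow> S - sum f {..<N}"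
    using assms(1) unfolding sums_def by (intro tendsto_intros LIMSEQ_ignore_initial_segment)
  show "psd (sum f {..<n + N} - sum f {..<N})" for n
  proof -
    have "sum f {..<n + N} = sum f {..<N} + sum f {N..<n + N}"
      by (simp add: lessThan_atLeast0 sum.atLeastLessThan_concat)
    then show ?thesis by (simp add: psd_sum assms(2))
  qed
qed

lemma psd_sums:
  assumes "f sums S" "\<And>i. psd (f i)"
  shows "psd S"
  using psd_sums_diff[OF assms, of 0] by simp

lemma psd_sums_diff_term:
  assumes "f sums S" "\<And>i. psd (f i)"
  shows "psd (S - f i)"
proof -
  have "psd (S - sum f {..<Suc i} + sum f {..<i})"
    by (intro psd_add psd_sums_diff psd_sum assms)
  then show ?thesis by simp
qed

text \<open>The witness \<open>M t p\<close> is \<open>t D\<^sup>-\<^sup>1\<^sup>/\<^sup>2 p\<close>, obtained as the limit of \<open>t (1/n + h)\<^sup>-\<^sup>1 p\<close> for \<open>h = D\<^sup>1\<^sup>/\<^sup>2\<close>.\<close>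

lemma intermediate_product:
  fixes D :: "'a::cstar_algebra"
  assumes D: "psd D"
  obtains M :: "'a \<Rightarrow> 'a \<Rightarrow> 'a" where
    "\<And>t p. psd (D - star t * t) \<Longrightarrow> (\<lambda>i. p i * star (p i)) sums D \<Longrightarrow>
       (\<lambda>i. M t (p i) * star (M t (p i))) sums (t * star t)"
    "\<And>t p. psd (D - p * star p) \<Longrightarrow> (\<lambda>k. star (t k) * t k) sums D \<Longrightarrow>
       (\<lambda>k. star (M (t k) p) * M (t k) p) sums (star p * p)"
proof -
  obtain h where h: "psd h" "h * h = D" using psd_sqrt[OF D] by blast
  have sh: "star h = h" by (rule psd_star[OF h(1)])
  define e where "e n = 1 / real (Suc n)" for n
  have e: "e n > 0" for n by (simp add: e_def)
  have "\<forall>n. \<exists>u. star u = u \<and> e n *\<^sub>R u = h - h * u \<and> u * h = h * u \<and> norm u \<le> 2"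
    using resolvent[OF h(1) e] by metis
  then obtain u where u: "\<And>n. star (u n) = u n" "\<And>n. e n *\<^sub>R u n = h - h * u n"
    "\<And>n. u n * h = h * u n" "\<And>n. norm (u n) \<le> 2"
    by metis
  \<comment> \<open>\<open>(1 - u n) / e n\<close> is the inverse of \<open>e n + h\<close>\<close>
  define T where "T n t = (1 / e n) *\<^sub>R (t - t * u n)" for n t
  define M where "M t p = lim (\<lambda>n. T n t * p)" for t p
  have huh: "h - h * u n = e n *\<^sub>R u n" for n by (simp add: u(2))
  have Th: "T n t * h = t * u n" for n t
  proof -
    have "(t - t * u n) * h = t * (h - h * u n)" by (simp add: algebra_simps u(3))
    then show ?thesis using e[of n] by (simp add: T_def huh)
  qed
  \<comment> \<open>Domination of \<open>star t * t\<close> by \<open>h * h\<close> transfers the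
    estimate for \<open>h - h * u n = e n u n\<close> to \<open>t\<close>.\<close>
  have tu: "(\<lambda>n. t * u n) \<longlonglongrightarrow> t" if t: "psd (D - star t * t)" for t
  proof -
    have "norm (t - t * u n) \<le> 2 * e n" for n
    proof -
      have "norm (t - t * u n) \<le> norm (h - h * u n)"
        using norm_diff_mult_mono[of h t 1 "u n"] t by (simp add: sh h(2))
      also have "\<dots> = e n * norm (u n)" using e[of n] by (simp add: huh)
      also have "\<dots> \<le> e n * 2" using e[of n] by (intro mult_left_mono u(4)) simp
      finally show ?thesis by simp
    qed
    moreover have "(\<lambda>n. 2 * e n) \<longlonglongrightarrow> 2 * 0"
      unfolding e_def by (intro tendsto_intros LIMSEQ_Suc[OF lim_1_over_n])
    ultimately have "(\<lambda>n. t - t * u n) \<longlonglongrightarrow> 0"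
      using Lim_null_comparison[of "\<lambda>n. t - t * u n" "\<lambda>n. 2 * e n" sequentially] by simp
    from tendsto_diff[OF tendsto_const[of t] this] show ?thesis by simp
  qed
  have conv: "(\<lambda>n. T n t * p) \<longlonglongrightarrow> M t p"
    if t: "psd (D - star t * t)" and p: "psd (D - p * star p)" for t p
  proof -
    \<comment> \<open>As \<open>p * star p \<le> h * h\<close>, the factor \<open>p\<close> on the
      right may be replaced by \<open>h\<close>, and \<open>T n t * h = t * u n\<close>
      converges.\<close>
    have bd: "norm (T m t * p - T n t * p) \<le> norm (t * u m - t * u n)" for m n
    proof -
      let ?X = "T m t - T n t"
      have "norm (star p * star ?X) \<le> norm (h * star ?X)"
        using norm_mult_mono[of h "star p" "star ?X"] p by (simp add: sh h(2) star_star)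
      then have "norm (star (?X * p)) \<le> norm (star (?X * h))" by (simp add: star_mult sh)
      then have "norm (?X * p) \<le> norm (?X * h)" by (simp only: norm_star)
      then show ?thesis by (simp add: left_diff_distrib Th)
    qed
    have "Cauchy (\<lambda>n. T n t * p)"
    proof (rule CauchyI)
      fix r :: real assume "0 < r"
      then obtain N where "\<forall>m\<ge>N. \<forall>n\<ge>N. norm (t * u m - t * u n) < r"
        using CauchyD[OF LIMSEQ_imp_Cauchy[OF tu[OF t]]] by blast
      then show "\<exists>N. \<forall>m\<ge>N. \<forall>n\<ge>N. norm (T m t * p - T n t * p) < r"
        using bd by (meson le_less_trans)
    qed
    then show ?thesis unfolding M_def by (simp add: Cauchy_convergent_iff convergent_LIMSEQ_iff)
  qed
  have 1: "(\<lambda>i. M t (p i) * star (M t (p i))) sums (t * star t)"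
    if t: "psd (D - star t * t)" and p: "(\<lambda>i. p i * star (p i)) sums D" for t p
  proof -
    let ?S = "\<lambda>N. \<Sum>i<N. p i * star (p i)" and ?V = "\<lambda>N. \<Sum>i<N. M t (p i) * star (M t (p i))"
    have pi: "psd (D - p i * star (p i))" for i
      by (rule psd_sums_diff_term[OF p]) (rule psd_mult_star_self)
    \<comment> \<open>Before the limit in \<open>n\<close> the error is
      \<open>T n t (D - ?S N) star (T n t)\<close>. Factor \<open>D - ?S N\<close> as
      \<open>r * r\<close>, then replace \<open>t\<close> by \<open>h\<close> to reach
      \<open>u n * r\<close>; 4 is the square of the bound 2 on \<open>norm (u n)\<close>.\<close>
    have bd: "norm (t * star t - ?V N) \<le> 4 * norm (D - ?S N)" for N
    proof -
      have "psd (D - ?S N)" by (rule psd_sums_diff[OF p]) (rule psd_mult_star_self)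
      then obtain r where r: "psd r" "r * r = D - ?S N" using psd_sqrt by blast
      have "norm (T n t * D * star (T n t) - (\<Sum>i<N. (T n t * p i) * star (T n t * p i)))
          \<le> 4 * norm (D - ?S N)" for n
      proof -
        have "T n t * D * star (T n t) - (\<Sum>i<N. (T n t * p i) * star (T n t * p i))
            = T n t * (D - ?S N) * star (T n t)"
          by (simp add: star_mult left_diff_distrib right_diff_distrib sum_distrib_left
              sum_distrib_right mult.assoc)
        also have "\<dots> = (T n t * r) * star (T n t * r)"
          by (simp add: r(2)[symmetric] star_mult psd_star[OF r(1)] mult.assoc)
        finally have eq: "norm (T n t * D * star (T n t)
            - (\<Sum>i<N. (T n t * p i) * star (T n t * p i))) = (norm (T n t * r))\<^sup>2"
          by (simp add: norm_mult_star)
        have "T n t * r = t * ((1 / e n) *\<^sub>R (r - u n * r))" by (simp add: T_def algebra_simps)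
        then have "norm (T n t * r) \<le> norm (h * ((1 / e n) *\<^sub>R (r - u n * r)))"
          using norm_mult_mono[of h t "(1 / e n) *\<^sub>R (r - u n * r)"] t by (simp only: sh h(2))
        also have "h * ((1 / e n) *\<^sub>R (r - u n * r)) = (1 / e n) *\<^sub>R ((h - h * u n) * r)"
          by (simp add: algebra_simps)
        also have "\<dots> = u n * r" using e[of n] by (simp add: huh)
        also have "norm (u n * r) \<le> 2 * norm r"
          by (meson mult_right_mono norm_ge_zero norm_mult_ineq order_trans u(4))
        finally have "(norm (T n t * r))\<^sup>2 \<le> (2 * norm r)\<^sup>2" by (rule power_mono) simp
        also have "\<dots> = 4 * norm (r * r)"
          using cstar_identity[of r] by (simp add: psd_star[OF r(1)] power_mult_distrib)
        finally show ?thesis by (simp add: eq r(2))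
      qed
      moreover have "(\<lambda>n. T n t * D * star (T n t) - (\<Sum>i<N. (T n t * p i) * star (T n t * p i)))
          \<longlonglongrightarrow> t * star t - ?V N"
      proof -
        have "T n t * D * star (T n t) = (t * u n) * star (t * u n)" for n
          by (simp only: Th[symmetric] star_mult sh h(2)[symmetric] mult.assoc)
        moreover have "(\<lambda>n. (t * u n) * star (t * u n)) \<longlonglongrightarrow> t * star t"
          by (rule tendsto_mult[OF tu[OF t] tendsto_star[OF tu[OF t]]])
        moreover have "(\<lambda>n. \<Sum>i<N. (T n t * p i) * star (T n t * p i)) \<longlonglongrightarrow> ?V N"
          by (rule tendsto_sum) (rule tendsto_mult[OF conv[OF t pi] tendsto_star[OF conv[OF t pi]]])
        ultimately show ?thesis by (simp only: tendsto_diff)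
      qed
      ultimately show ?thesis
        using LIMSEQ_le_const2[OF tendsto_norm] by blast
    qed
    have "(\<lambda>N. 4 * norm (D - ?S N)) \<longlonglongrightarrow> 4 * norm (D - D)"
      using p unfolding sums_def by (intro tendsto_intros)
    then have "(\<lambda>N. t * star t - ?V N) \<longlonglongrightarrow> 0"
      using Lim_null_comparison[of "\<lambda>N. t * star t - ?V N" "\<lambda>N. 4 * norm (D - ?S N)" sequentially] bd
      by simp
    from tendsto_diff[OF tendsto_const[of "t * star t"] this]
    show ?thesis unfolding sums_def by simp
  qed
  have 2: "(\<lambda>k. star (M (t k) p) * M (t k) p) sums (star p * p)"
    if p: "psd (D - p * star p)" and t: "(\<lambda>k. star (t k) * t k) sums D" for t p
  proof -
    \<comment> \<open>Adjoints exchange the arguments of \<open>M\<close>, so the second formula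
      reduces to the first.\<close>
    have "star (M (t k) p) = M (star p) (star (t k))" for k
    proof (rule LIMSEQ_unique)
      have tk: "psd (D - star (t k) * t k)"
        using psd_sums_diff_term[OF t] psd_star_mult_self by blast
      show "(\<lambda>n. star (T n (t k) * p)) \<longlonglongrightarrow> star (M (t k) p)"
        by (intro tendsto_star conv tk p)
      have "star (T n (t k) * p) = T n (star p) * star (t k)" for n
        by (simp add: T_def star_mult star_scaleR star_diff u(1) algebra_simps)
      moreover have "(\<lambda>n. T n (star p) * star (t k)) \<longlonglongrightarrow> M (star p) (star (t k))"
        by (rule conv) (simp_all add: star_star p tk)
      ultimately show "(\<lambda>n. star (T n (t k) * p)) \<longlonglongrightarrow> M (star p) (star (t k))" by simp
    qed
    moreover from this have "M (t k) p = star (M (star p) (star (t k)))" for k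
      by (metis star_star)
    ultimately show ?thesis
      using 1[of "star p" "\<lambda>k. star (t k)"] p t by (simp add: star_star)
  qed
  show ?thesis by (rule that[of M], erule 1, assumption, erule 2, assumption)
qed

section \<open>The Cuntz--Pedersen equivalence\<close>

text \<open>This is \<open>cstar_equiv UNIV\<close> without the positivity conditions, which the two
  series imply.\<close>

definition sim :: "'a::cstar_algebra \<Rightarrow> 'a \<Rightarrow> bool" where
  "sim x y \<longleftrightarrow> (\<exists>z::nat \<Rightarrow> 'a. (\<lambda>k. star (z k) * z k) sums x \<and> (\<lambda>k. z k * star (z k)) sums y)"

lemma simI:
  "(\<lambda>k. star (z k) * z k) sums x \<Longrightarrow> (\<lambda>k. z k * star (z k)) sums y \<Longrightarrow> sim x y"
  unfolding sim_def by blast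

lemma sim_psd:
  assumes "sim x y"
  shows "psd x" and "psd y"
  using assms psd_sums psd_star_mult_self psd_mult_star_self unfolding sim_def by blast+

lemma cstar_equiv_UNIV_iff: "cstar_equiv UNIV x y \<longleftrightarrow> sim x y"
proof -
  have "cstar_equiv UNIV x y \<longleftrightarrow> psd x \<and> psd y \<and> sim x y"
    by (simp add: cstar_equiv_def cstar_pos_UNIV_iff sim_def)
  then show ?thesis using sim_psd[of x y] by blast
qed

lemma sim_sym: "sim x y \<Longrightarrow> sim y x"
proof -
  assume "sim x y"
  then obtain z where "(\<lambda>k. star (z k) * z k) sums x" "(\<lambda>k. z k * star (z k)) sums y"
    unfolding sim_def by blast
  then show ?thesis unfolding sim_def by (intro exI[of _ "\<lambda>k. star (z k)"]) (simp add: star_star)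
qed

lemma sim_star_mult_self: "sim (star z * z) (z * star z)"
proof -
  define w where "w k = (if k = 0 then z else 0)" for k :: nat
  have "(\<lambda>k. star (w k) * w k) sums (\<Sum>k\<in>{0}. star (w k) * w k)"
    by (rule sums_finite) (simp_all add: w_def)
  moreover have "(\<lambda>k. w k * star (w k)) sums (\<Sum>k\<in>{0}. w k * star (w k))"
    by (rule sums_finite) (simp_all add: w_def)
  ultimately show ?thesis unfolding sim_def by (intro exI[of _ w]) (simp add: w_def)
qed

lemma sim_refl:
  assumes "psd x"
  shows "sim x x"
proof -
  obtain h where "psd h" "h * h = x" using psd_sqrt[OF assms] by blast
  then show ?thesis using sim_star_mult_self[of h] by (simp add: psd_star)
qed

lemma sim_scaleR:
  assumes "sim x y" "0 \<le> r"
  shows "sim (r *\<^sub>R x) (r *\<^sub>R y)"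
proof -
  obtain z where z: "(\<lambda>k. star (z k) * z k) sums x" "(\<lambda>k. z k * star (z k)) sums y"
    using assms(1) unfolding sim_def by blast
  have "(\<lambda>k. star (sqrt r *\<^sub>R z k) * (sqrt r *\<^sub>R z k)) sums (r *\<^sub>R x)"
    using sums_scaleR_right[OF z(1), of r] assms(2) by (simp add: star_scaleR)
  moreover have "(\<lambda>k. (sqrt r *\<^sub>R z k) * star (sqrt r *\<^sub>R z k)) sums (r *\<^sub>R y)"
    using sums_scaleR_right[OF z(2), of r] assms(2) by (simp add: star_scaleR)
  ultimately show ?thesis unfolding sim_def by (intro exI[of _ "\<lambda>k. sqrt r *\<^sub>R z k"]) simp
qed

lemma sim_zero_right: "sim x 0 \<Longrightarrow> x = 0"
proof -
  assume "sim x 0"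
  then obtain z where z: "(\<lambda>k. star (z k) * z k) sums x" "(\<lambda>k. z k * star (z k)) sums 0"
    unfolding sim_def by blast
  have "z k = 0" for k
  proof -
    have "psd (0 - z k * star (z k))"
      by (rule psd_sums_diff_term[OF z(2)]) (rule psd_mult_star_self)
    then have "z k * star (z k) = 0" by (intro psd_antisym psd_mult_star_self) simp
    then show ?thesis using norm_mult_star[of "z k"] by simp
  qed
  then show ?thesis using z(1) by (simp add: sums_iff)
qed

text \<open>No absolute convergence is available. Instead, a finite partial sum over a superset of a
  large rectangle lies between the rectangle sum and \<open>S\<close>, and the norm is monotone on
  the positive cone; this gives unconditional convergence.\<close>

lemma psd_double_sums:
  fixes c :: "nat \<Rightarrow> nat \<Rightarrow> 'a::cstar_algebra"
  assumes c: "\<And>k j. psd (c k j)" and C: "\<And>k. c k sums C k" and S: "C sums S"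
    and e: "bij e"
  shows "(\<lambda>n. c (fst (e n)) (snd (e n))) sums S"
proof -
  let ?f = "\<lambda>i. c (fst i) (snd i)"
  have CP: "psd (C k)" for k by (rule psd_sums[OF C c])
  have rect: "sum ?f ({..<N} \<times> {..<J}) = (\<Sum>k<N. \<Sum>j<J. c k j)" for N J
    by (simp add: sum.cartesian_product case_prod_unfold)
  have le_rect: "psd (S - sum ?f ({..<N} \<times> {..<J}))" for N J
  proof -
    have "psd ((S - sum C {..<N}) + (\<Sum>k<N. C k - (\<Sum>j<J. c k j)))"
      by (intro psd_add psd_sum psd_sums_diff[OF S CP] psd_sums_diff[OF C c])
    then show ?thesis by (simp add: rect sum_subtractf)
  qed
  have diff: "psd (sum ?f Y - sum ?f X)" if "finite Y" "X \<subseteq> Y" for X Y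
    using sum_diff[OF that, of ?f] by (metis psd_sum c)
  have le: "psd (S - sum ?f Y)" if Y: "finite Y" for Y
  proof -
    obtain N where N: "fst ` Y \<union> snd ` Y \<subseteq> {..<N}"
      using finite_nat_bounded[of "fst ` Y \<union> snd ` Y"] Y by auto
    then have "Y \<subseteq> {..<N} \<times> {..<N}" by force
    then have "psd ((S - sum ?f ({..<N} \<times> {..<N})) + (sum ?f ({..<N} \<times> {..<N}) - sum ?f Y))"
      by (intro psd_add le_rect diff) auto
    then show ?thesis by simp
  qed
  have "(?f has_sum S) UNIV"
    unfolding has_sum_def tendsto_iff
  proof (intro allI impI)
    fix r :: real assume r: "0 < r"
    then have r2: "0 < r / 2" by simp
    obtain N where N: "dist (sum C {..<N}) S < r / 2"
      using tendstoD[OF S[unfolded sums_def] r2] unfolding eventually_sequentially by blast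
    have "(\<lambda>J. \<Sum>k<N. \<Sum>j<J. c k j) \<longlonglongrightarrow> sum C {..<N}"
      using C unfolding sums_def by (intro tendsto_sum)
    from tendstoD[OF this r2] obtain J where J: "dist (\<Sum>k<N. \<Sum>j<J. c k j) (sum C {..<N}) < r / 2"
      unfolding eventually_sequentially by blast
    define X where "X = {..<N} \<times> {..<J}"
    have X: "norm (S - sum ?f X) < r"
      using N J dist_triangle[of S "\<Sum>k<N. \<Sum>j<J. c k j" "sum C {..<N}"]
      unfolding X_def rect dist_norm by (simp add: norm_minus_commute)
    have "dist (sum ?f Y) S < r" if Y: "finite Y" "X \<subseteq> Y" for Y
    proof -
      have "norm (S - sum ?f Y) \<le> norm (S - sum ?f X)"
        by (rule psd_norm_mono[OF le[OF Y(1)]]) (use diff[OF Y] in simp)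
      then show ?thesis using X by (simp add: dist_norm norm_minus_commute)
    qed
    then show "\<forall>\<^sub>F Y in finite_subsets_at_top UNIV. dist (sum ?f Y) S < r"
      unfolding eventually_finite_subsets_at_top by (intro exI[of _ X]) (simp add: X_def)
  qed
  then have "((\<lambda>n. ?f (e n)) has_sum S) UNIV"
    using has_sum_reindex_bij_betw[OF e, of ?f S] by simp
  then show ?thesis by (rule has_sum_imp_sums)
qed

text \<open>Enumerates pairs with exchanged coordinates, so that one family can be summed first over
  either index.\<close>

lemma bij_swap_prod_decode: "bij (prod.swap \<circ> prod_decode)"
  by (intro bij_comp bij_prod_decode bij_swap)

lemma sim_sums:
  assumes "\<And>i. sim (x i) (y i)" "x sums X" "y sums Y"
  shows "sim X Y"
proof -
  have "\<forall>i. \<exists>z. (\<lambda>k. star (z k) * z k) sums x i \<and> (\<lambda>k. z k * star (z k)) sums y i"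
    using assms(1) unfolding sim_def by blast
  then obtain z where z: "\<And>i. (\<lambda>k. star (z i k) * z i k) sums x i"
    "\<And>i. (\<lambda>k. z i k * star (z i k)) sums y i"
    by metis
  let ?w = "\<lambda>n. z (fst (prod_decode n)) (snd (prod_decode n))"
  have "(\<lambda>n. star (?w n) * ?w n) sums X"
    by (rule psd_double_sums[OF psd_star_mult_self z(1) assms(2) bij_prod_decode])
  moreover have "(\<lambda>n. ?w n * star (?w n)) sums Y"
    by (rule psd_double_sums[OF psd_mult_star_self z(2) assms(3) bij_prod_decode])
  ultimately show ?thesis by (rule simI)
qed

text \<open>The family \<open>M (w j) (z k)\<close> implements the equivalence: summing over
  \<open>j\<close> recovers \<open>star (z k) * z k\<close>, and summing over \<open>k\<close>
  recovers \<open>w j * star (w j)\<close>.\<close>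

lemma sim_trans:
  assumes "sim x D" "sim D y"
  shows "sim x y"
proof -
  obtain z where z: "(\<lambda>k. star (z k) * z k) sums x" "(\<lambda>k. z k * star (z k)) sums D"
    using assms(1) unfolding sim_def by blast
  obtain w where w: "(\<lambda>k. star (w k) * w k) sums D" "(\<lambda>k. w k * star (w k)) sums y"
    using assms(2) unfolding sim_def by blast
  obtain M where M:
    "\<And>t p. psd (D - star t * t) \<Longrightarrow> (\<lambda>i. p i * star (p i)) sums D \<Longrightarrow>
       (\<lambda>i. M t (p i) * star (M t (p i))) sums (t * star t)"
    "\<And>t p. psd (D - p * star p) \<Longrightarrow> (\<lambda>k. star (t k) * t k) sums D \<Longrightarrow>
       (\<lambda>k. star (M (t k) p) * M (t k) p) sums (star p * p)"
    using intermediate_product[OF sim_psd(2)[OF assms(1)]] by blast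
  define v where "v n = M (w (snd (prod_decode n))) (z (fst (prod_decode n)))" for n
  have "psd (D - z k * star (z k))" for k
    by (rule psd_sums_diff_term[OF z(2)]) (rule psd_mult_star_self)
  note c1 = M(2)[OF this w(1)]
  have "psd (D - star (w j) * w j)" for j
    by (rule psd_sums_diff_term[OF w(1)]) (rule psd_star_mult_self)
  note c2 = M(1)[OF this z(2)]
  have "(\<lambda>n. star (v n) * v n) sums x"
    unfolding v_def by (rule psd_double_sums[OF psd_star_mult_self c1 z(1) bij_prod_decode])
  moreover have "(\<lambda>n. v n * star (v n)) sums y"
    using psd_double_sums[OF psd_mult_star_self c2 w(2) bij_swap_prod_decode]
    by (simp add: v_def)
  ultimately show ?thesis by (rule simI)
qed

lemma sim_add:
  assumes "sim x y" "sim x' y'"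
  shows "sim (x + x') (y + y')"
proof (rule sim_sums)
  define f where "f a b i = (if i = 0 then a else if i = Suc 0 then b else 0)" for a b :: 'a and i
  have "f a b sums (\<Sum>i\<in>{0, Suc 0}. f a b i)" for a b
    by (rule sums_finite) (auto simp: f_def)
  then have f: "f a b sums (a + b)" for a b by (simp add: f_def)
  show "f x x' sums (x + x')" "f y y' sums (y + y')" by (rule f)+
  show "sim (f x x' i) (f y y' i)" for i
    using assms by (simp add: f_def sim_refl)
qed

lemma psd_summable_comparison:
  assumes "\<And>k. psd (f k)" "\<And>k. psd (g k - f k)" "summable g"
  shows "summable f"
  unfolding summable_Cauchy
proof (intro allI impI)
  fix e :: real assume "0 < e"
  then obtain N where N: "\<And>m n. m \<ge> N \<Longrightarrow> norm (sum g {m..<n}) < e"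
    using assms(3) unfolding summable_Cauchy by blast
  have "norm (sum f {m..<n}) \<le> norm (sum g {m..<n})" for m n
    by (rule psd_norm_mono) (simp_all add: psd_sum assms flip: sum_subtractf)
  then show "\<exists>N. \<forall>m\<ge>N. \<forall>n. norm (sum f {m..<n}) < e"
    using N by (meson le_less_trans)
qed

text \<open>Riesz decomposition. With roots \<open>g\<close> of \<open>j\<close> and
  \<open>r\<close> of \<open>q\<close>, one has \<open>D = g * star g + r * star r\<close>, and
  \<open>M (z k)\<close> splits each \<open>z k * star (z k)\<close> into a part through
  \<open>g\<close> and a part through \<open>r\<close>.\<close>

lemma sim_split:
  assumes sim: "sim (j + q) w" and j: "psd j" and q: "psd q"
  obtains j' q' where "w = j' + q'" "sim j j'" "sim q q'"
proof -
  let ?D = "j + q"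
  obtain z where z: "(\<lambda>k. star (z k) * z k) sums ?D" "(\<lambda>k. z k * star (z k)) sums w"
    using sim unfolding sim_def by blast
  have D: "psd ?D" by (intro psd_add j q)
  obtain M where M:
    "\<And>t p. psd (?D - star t * t) \<Longrightarrow> (\<lambda>i. p i * star (p i)) sums ?D \<Longrightarrow>
       (\<lambda>i. M t (p i) * star (M t (p i))) sums (t * star t)"
    "\<And>t p. psd (?D - p * star p) \<Longrightarrow> (\<lambda>k. star (t k) * t k) sums ?D \<Longrightarrow>
       (\<lambda>k. star (M (t k) p) * M (t k) p) sums (star p * p)"
    using intermediate_product[OF D] by blast
  obtain g where g: "psd g" "g * g = j" using psd_sqrt[OF j] by blast
  obtain r where r: "psd r" "r * r = q" using psd_sqrt[OF q] by blast
  note sg = psd_star[OF g(1)] and sr = psd_star[OF r(1)]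
  define v where "v p k = M (z k) p" for p k
  have vg: "(\<lambda>k. star (v g k) * v g k) sums j"
    unfolding v_def using M(2)[of g z] z(1) q by (simp add: sg g(2))
  have vr: "(\<lambda>k. star (v r k) * v r k) sums q"
    unfolding v_def using M(2)[of r z] z(1) j by (simp add: sr r(2))
  \<comment> \<open>Only the summation formulas for \<open>M\<close> are at hand, so this is read
    off from a series with sum 0. It disposes of the zero padding of \<open>p\<close> below.\<close>
  have v0: "v 0 k = 0" for k
  proof -
    have s: "(\<lambda>k. star (v 0 k) * v 0 k) sums 0"
      unfolding v_def using M(2)[of 0 z] z(1) D by simp
    have "psd (0 - star (v 0 k) * v 0 k)"
      by (rule psd_sums_diff_term[OF s]) (rule psd_star_mult_self)
    then have "star (v 0 k) * v 0 k = 0" by (intro psd_antisym psd_star_mult_self) simp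
    then show ?thesis by (simp add: star_mult_self_eq_0)
  qed
  have split: "z k * star (z k) = v g k * star (v g k) + v r k * star (v r k)" for k
  proof -
    define p where "p i = (if i = 0 then g else if i = Suc 0 then r else 0)" for i
    have "(\<lambda>i. p i * star (p i)) sums (\<Sum>i\<in>{0, Suc 0}. p i * star (p i))"
      by (rule sums_finite) (auto simp: p_def)
    then have "(\<lambda>i. p i * star (p i)) sums ?D" by (simp add: p_def sg sr g(2) r(2))
    moreover have "psd (?D - star (z k) * z k)"
      by (rule psd_sums_diff_term[OF z(1)]) (rule psd_star_mult_self)
    ultimately have "(\<lambda>i. v (p i) k * star (v (p i) k)) sums (z k * star (z k))"
      unfolding v_def by (intro M(1))
    moreover have "(\<lambda>i. v (p i) k * star (v (p i) k)) sums
        (\<Sum>i\<in>{0, Suc 0}. v (p i) k * star (v (p i) k))"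
      by (rule sums_finite) (auto simp: p_def v0)
    ultimately show ?thesis using sums_unique2 by (fastforce simp: p_def)
  qed
  have "summable (\<lambda>k. v g k * star (v g k))"
    by (rule psd_summable_comparison[where g = "\<lambda>k. z k * star (z k)"])
      (use z(2) in \<open>simp_all add: psd_mult_star_self split sums_summable\<close>)
  then obtain j' where j': "(\<lambda>k. v g k * star (v g k)) sums j'" by blast
  have q': "(\<lambda>k. v r k * star (v r k)) sums (w - j')"
    using sums_diff[OF z(2) j'] by (simp add: split)
  have "sim j j'" "sim q (w - j')" by (rule simI[OF vg j'], rule simI[OF vr q'])
  then show ?thesis using that[of j' "w - j'"] by simp
qed

section \<open>Finite elements\<close>

lemma finite_in_UNIV_iff:
  "finite_in UNIV x \<longleftrightarrow> psd x \<and> (\<forall>y. psd y \<longrightarrow> psd (x - y) \<longrightarrow> sim y x \<longrightarrow> y = x)"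
  by (simp add: finite_in_def cstar_pos_UNIV_iff cstar_equiv_UNIV_iff cstar_le_def Ball_def)

text \<open>Transport \<open>b = y + (b - y)\<close> to \<open>b' = y' + d'\<close> by Riesz
  decomposition. Adding \<open>x - b'\<close> turns \<open>y' \<sim> b'\<close> into an equivalence
  between \<open>x - d'\<close> and \<open>x\<close>, so \<open>d' = 0\<close>.\<close>

lemma finite_in_of_sim_le:
  assumes x: "finite_in UNIV x" and b: "sim b b'" and le: "psd (x - b')"
  shows "finite_in UNIV b"
  unfolding finite_in_UNIV_iff
proof (intro conjI allI impI)
  show "psd b" by (rule sim_psd(1)[OF b])
  fix y assume y: "psd y" "psd (b - y)" "sim y b"
  have "sim (y + (b - y)) b'" using b by simp
  then obtain y' d' where b': "b' = y' + d'" and yy': "sim y y'" and dd': "sim (b - y) d'"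
    using sim_split[OF _ y(1,2)] by blast
  have "sim y' b'" using sim_trans sim_sym yy' y(3) b by blast
  then have "sim (y' + (x - b')) (b' + (x - b'))" by (intro sim_add sim_refl le)
  moreover have "psd (y' + (x - b'))" by (intro psd_add sim_psd(2)[OF yy'] le)
  moreover have "psd (x - (y' + (x - b')))" using sim_psd(2)[OF dd'] by (simp add: b')
  ultimately have "y' + (x - b') = x" using x unfolding finite_in_UNIV_iff by simp
  then have "d' = 0" by (simp add: b' algebra_simps)
  then show "y = b" using sim_zero_right dd' by force
qed

section \<open>Prime algebras and finite ideals\<close>

lemma cstar_prime_sandwich:
  assumes "cstar_prime (UNIV :: 'a::cstar_algebra set)" and sand: "\<And>c. x * c * s = (0::'a)"
  shows "x = 0 \<or> s = 0"
proof -
  \<comment> \<open>Annihilators are used because they contain \<open>x\<close> and \<open>s\<close>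
    even without a unit.\<close>
  define I where "I = {y. \<forall>c. y * c * s = 0}"
  define J where "J = {z. \<forall>y\<in>I. \<forall>c. y * c * z = 0}"
  have zero: "l *\<^sub>C (0::'a) = 0" for l
    using norm_scaleC[of l "0::'a"] by simp
  have "cstar_ideal UNIV I"
    unfolding cstar_ideal_def
  proof (intro conjI ballI allI)
    fix a y assume "y \<in> I"
    then have y: "y * c * s = 0" for c by (simp add: I_def)
    show "a * y \<in> I" using y by (simp add: I_def mult.assoc)
    show "y * a \<in> I" using y[of "a * c" for c] by (simp add: I_def mult.assoc)
    show "l *\<^sub>C y \<in> I" for l using y by (simp add: I_def mult_scaleC_left zero)
  qed (simp_all add: I_def distrib_right)
  moreover have "cstar_ideal UNIV J"
    unfolding cstar_ideal_def
  proof (intro conjI ballI allI)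
    fix a z assume "z \<in> J"
    then have z: "y * c * z = 0" if "y \<in> I" for y c using that by (simp add: J_def)
    show "a * z \<in> J" using z[of _ "c * a" for c] by (simp add: J_def mult.assoc)
    show "z * a \<in> J" using z by (simp add: J_def flip: mult.assoc)
    show "l *\<^sub>C z \<in> J" for l using z by (simp add: J_def mult_scaleC_right zero)
  qed (simp_all add: J_def distrib_left)
  moreover have "\<forall>y\<in>I. \<forall>z\<in>J. y * z \<in> {0}"
  proof (intro ballI)
    fix y z assume "y \<in> I" "z \<in> J"
    \<comment> \<open>Membership in \<open>J\<close> kills products with a middle factor. This
      factor makes the product \<open>v * star v * v\<close> for \<open>v = y * z\<close>, which
      vanishes only if \<open>v\<close> does.\<close>
    then have "y * (z * star z * star y * y) * z = 0" unfolding J_def by blast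
    then have "star (star (y * z) * (y * z)) * (star (y * z) * (y * z)) = 0"
      by (simp add: star_mult star_star mult.assoc)
    then show "y * z \<in> {0}" by (simp add: star_mult_self_eq_0)
  qed
  ultimately have "I \<subseteq> {0} \<or> J \<subseteq> {0}"
    using assms(1) unfolding cstar_prime_def cstar_prime_ideal_def by blast
  moreover have "x \<in> I" "s \<in> J" using sand unfolding I_def J_def by blast+
  ultimately show ?thesis by blast
qed

text \<open>Rescale the middle factor given by primeness. The two norm bounds permit comparison of
  \<open>x * c * s\<close> with either end.\<close>

lemma cstar_prime_connecting:
  assumes "cstar_prime (UNIV :: 'a::cstar_algebra set)" "x \<noteq> 0" "s \<noteq> (0::'a)"
  obtains c where "norm (x * c) \<le> 1" "norm (c * s) \<le> 1" "x * c * s \<noteq> 0"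
proof -
  obtain c where c: "x * c * s \<noteq> 0" using cstar_prime_sandwich assms by metis
  define l where "l = norm (x * c) + norm (c * s) + 1"
  have l: "norm (x * c) \<le> l" "norm (c * s) \<le> l" "0 < l"
    unfolding l_def by (simp_all add: add_nonneg_pos)
  show ?thesis
    by (rule that[of "(1 / l) *\<^sub>R c"]) (use l c in simp_all)
qed

text \<open>The difference is \<open>(f s)\<^sup>* (f s)\<close> for \<open>f = (1 - e\<^sup>* e)\<^sup>1\<^sup>/\<^sup>2\<close> in the unitization.\<close>

lemma psd_diff_contraction:
  fixes e s :: "'a::cstar_algebra"
  assumes "norm e \<le> 1"
  shows "psd (star s * s - star (e * s) * (e * s))"
proof -
  have "upos 1 (- (star e * e))"
    unfolding upos_def
  proof (intro conjI exI allI)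
    fix y
    have "norm (star e * e) \<le> 1" using assms by (simp add: cstar_identity power_le_one)
    then have "norm (star e * e * y) \<le> 1 * norm y"
      by (meson mult_right_mono norm_ge_zero norm_mult_ineq order_trans)
    then show "norm ((1 - 1) *\<^sub>R y - - (star e * e) * y) \<le> 1 * norm y" by simp
  qed (simp_all add: star_minus star_mult star_star)
  then obtain x where "upos (sqrt 1) x" and x: "(2 * sqrt 1) *\<^sub>R x + x * x = - (star e * e)"
    using upos_sqrt by (metis zero_le_one)
  then have sx: "star x = x" by (simp add: upos_def)
  have "star (s + x * s) * (s + x * s) = star s * s + star s * ((2 * sqrt 1) *\<^sub>R x + x * x) * s"
    by (simp add: star_add star_mult sx algebra_simps scaleR_2)
  also have "\<dots> = star s * s - star (e * s) * (e * s)"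
    unfolding x by (simp add: star_mult mult.assoc)
  finally show ?thesis by (metis psd_star_mult_self)
qed

section \<open>Abelian and finite elements in prime algebras\<close>

lemma commute_closure:
  fixes S :: "'a::cstar_algebra set"
  assumes "\<And>u v. u \<in> S \<Longrightarrow> v \<in> S \<Longrightarrow> u * v = v * u" "u \<in> closure S" "v \<in> closure S"
  shows "u * v = v * u"
proof -
  obtain f g where f: "\<And>n. f n \<in> S" "f \<longlonglongrightarrow> u" and g: "\<And>n. g n \<in> S" "g \<longlonglongrightarrow> v"
    using assms(2,3) unfolding closure_sequential by blast
  have "(\<lambda>n. f n * g n) \<longlonglongrightarrow> u * v" "(\<lambda>n. g n * f n) \<longlonglongrightarrow> v * u"
    by (intro tendsto_mult f g)+
  moreover have "f n * g n = g n * f n" for n by (rule assms(1)[OF f(1) g(1)])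
  ultimately show ?thesis by (simp add: LIMSEQ_unique)
qed

text \<open>A product of two elements of \<open>?b A ?b\<close> is
  \<open>star z * (P * R * Q) * z\<close> with all three inner factors in the commuting set
  \<open>x A x\<close>; reversing the product only swaps \<open>P\<close> and
  \<open>Q\<close>.\<close>

lemma abelian_in_star_mult_self:
  fixes x w :: "'a::cstar_algebra"
  assumes "abelian_in UNIV x"
  shows "abelian_in UNIV (star (x * w) * (x * w))"
proof -
  have sx: "star x = x" using assms psd_star by (auto simp: abelian_in_def cstar_pos_UNIV_iff)
  define z where "z = x * w"
  have comm: "x * a * x * (x * b * x) = x * b * x * (x * a * x)" for a b
    using assms closure_subset[of "{x * a * x | a. a \<in> UNIV}"] unfolding abelian_in_def by blast
  have sand: "z * p * star z = x * (w * p * star w) * x" for p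
    by (simp add: z_def star_mult sx mult.assoc)
  have sq: "z * star z = x * (w * star w) * x"
    by (simp add: z_def star_mult sx mult.assoc)
  let ?b = "star z * z"
  let ?S = "{?b * a * ?b | a. a \<in> UNIV}"
  have "u * v = v * u" if u: "u \<in> ?S" and v: "v \<in> ?S" for u v
  proof -
    obtain p q where u: "u = ?b * p * ?b" and v: "v = ?b * q * ?b" using u v by blast
    define P Q R where "P = z * p * star z" and "Q = z * q * star z" and "R = z * star z"
    have c: "P * R = R * P" "Q * R = R * Q" "P * Q = Q * P"
      unfolding P_def Q_def R_def sand sq by (rule comm)+
    have "P * R * Q = Q * R * P" by (metis c mult.assoc)
    moreover have "u * v = star z * (P * R * Q) * z" "v * u = star z * (Q * R * P) * z"
      by (simp_all add: u v P_def Q_def R_def mult.assoc)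
    ultimately show ?thesis by simp
  qed
  note comm' = commute_closure[of ?S, OF this]
  have "?b \<in> cstar_pos UNIV" by (simp only: cstar_pos_UNIV_iff psd_star_mult_self)
  then show ?thesis
    unfolding abelian_in_def z_def[symmetric] using comm' by (intro conjI ballI)
qed

lemma cstar_prime_abelian_imp_discrete:
  assumes prime: "cstar_prime (UNIV :: 'a::cstar_algebra set)"
    and x: "abelian_in UNIV (x::'a)" "x \<noteq> 0"
  shows "cstar_discrete (UNIV :: 'a set)"
  unfolding cstar_discrete_def
proof (intro ballI impI)
  fix a :: 'a assume "a \<in> cstar_pos UNIV" "a \<noteq> 0"
  then obtain s where s: "a = star s * s" "s \<noteq> 0"
    unfolding cstar_pos_def using mult_zero_right by blast
  obtain c where c: "norm (x * c) \<le> 1" "x * c * s \<noteq> 0"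
    using cstar_prime_connecting[OF prime x(2) s(2)] by blast
  let ?b = "star (x * (c * s)) * (x * (c * s))"
  have "abelian_in UNIV ?b" by (rule abelian_in_star_mult_self[OF x(1)])
  moreover have "?b \<noteq> 0" using c(2) by (simp add: star_mult_self_eq_0 mult.assoc)
  moreover have "cstar_le UNIV ?b a"
    using psd_diff_contraction[OF c(1), of s]
    by (simp add: cstar_le_def cstar_pos_UNIV_iff s(1) mult.assoc)
  ultimately show "\<exists>b. abelian_in UNIV b \<and> b \<noteq> 0 \<and> cstar_le UNIV b a" by blast
qed

lemma cstar_prime_finite_imp_semifinite:
  assumes prime: "cstar_prime (UNIV :: 'a::cstar_algebra set)"
    and x: "finite_in UNIV (x::'a)" "x \<noteq> 0"
  shows "cstar_semifinite (UNIV :: 'a set)"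
  unfolding cstar_semifinite_def
proof (intro ballI impI)
  fix a :: 'a assume "a \<in> cstar_pos UNIV" "a \<noteq> 0"
  then obtain s where s: "a = star s * s" "s \<noteq> 0"
    unfolding cstar_pos_def using mult_zero_right by blast
  obtain r where r: "psd r" "r * r = x"
    using psd_sqrt x(1) unfolding finite_in_UNIV_iff by metis
  have "r \<noteq> 0" using r(2) x(2) by auto
  then obtain c where c: "norm (r * c) \<le> 1" "norm (c * s) \<le> 1" "r * c * s \<noteq> 0"
    using cstar_prime_connecting[OF prime _ s(2)] by blast
  let ?z = "r * (c * s)"
  \<comment> \<open>Contractivity of \<open>c * s\<close> puts \<open>?z * star ?z\<close> below
    \<open>r * r = x\<close>; that of \<open>r * c\<close> puts \<open>star ?z * ?z\<close> below
    \<open>a\<close>.\<close>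
  have "norm (star (c * s)) \<le> 1" using c(2) by (simp only: norm_star)
  from psd_diff_contraction[OF this, of r] have "psd (x - ?z * star ?z)"
    by (simp add: star_mult star_star psd_star[OF r(1)] r(2) mult.assoc)
  then have "finite_in UNIV (star ?z * ?z)"
    by (rule finite_in_of_sim_le[OF x(1) sim_star_mult_self])
  moreover have "star ?z * ?z \<noteq> 0" using c(3) by (simp add: star_mult_self_eq_0 mult.assoc)
  moreover have "cstar_le UNIV (star ?z * ?z) a"
    using psd_diff_contraction[OF c(1), of s]
    by (simp add: cstar_le_def cstar_pos_UNIV_iff s(1) mult.assoc)
  ultimately show "\<exists>b. finite_in UNIV b \<and> b \<noteq> 0 \<and> cstar_le UNIV b a" by blast
qed

section \<open>Closed ideals as algebras in their own right\<close>

locale closed_cstar_ideal =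
  fixes J :: "'a::cstar_algebra set"
  assumes ideal: "cstar_ideal UNIV J" and closed: "closed J"
begin

lemma zero_mem: "0 \<in> J"
  and add_mem: "x \<in> J \<Longrightarrow> y \<in> J \<Longrightarrow> x + y \<in> J"
  and mult_mem_left: "x \<in> J \<Longrightarrow> a * x \<in> J"
  and mult_mem_right: "x \<in> J \<Longrightarrow> x * a \<in> J"
  using ideal by (auto simp: cstar_ideal_def)

lemma scaleR_mem: "x \<in> J \<Longrightarrow> r *\<^sub>R x \<in> J"
  using ideal by (simp add: cstar_ideal_def flip: scaleC_of_real)

lemma diff_mem: "x \<in> J \<Longrightarrow> y \<in> J \<Longrightarrow> x - y \<in> J"
  using add_mem[of x "(-1) *\<^sub>R y"] scaleR_mem[of y "-1"] by simp

lemma sums_mem: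
  assumes "\<And>n. f n \<in> J" "f sums S"
  shows "S \<in> J"
proof (rule closed_sequentially[OF closed])
  show "sum f {..<n} \<in> J" for n
    by (induction n) (simp_all add: zero_mem add_mem assms(1))
  show "(\<lambda>n. sum f {..<n}) \<longlonglongrightarrow> S" using assms(2) by (simp add: sums_def)
qed

text \<open>The elements \<open>u n = D (e n + D)\<^sup>-\<^sup>1\<close> of \<open>J\<close> act as
  an approximate unit on \<open>z\<close>: the squared norm of \<open>z (1 - u n)\<close> is at most
  that of \<open>k (1 - u n)\<close>, which equals the norm of
  \<open>e n (1 - u n) u n\<close>.\<close>

lemma mem_of_psd_diff:
  assumes D: "D \<in> J" and le: "psd (D - star z * z)"
  shows "z \<in> J"
proof -
  have "psd (D - star z * z + star z * z)" by (rule psd_add[OF le psd_star_mult_self])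
  then have pD: "psd D" by simp
  obtain k where k: "psd k" "k * k = D" using psd_sqrt[OF pD] by blast
  define e where "e n = 1 / real (Suc n)" for n
  have e: "e n > 0" for n by (simp add: e_def)
  have "\<forall>n. \<exists>u. star u = u \<and> e n *\<^sub>R u = D - D * u \<and> norm u \<le> 2 \<and> (\<forall>y. norm (y - u * y) \<le> norm y)"
    using resolvent[OF pD e] by metis
  then obtain u where u: "\<And>n. star (u n) = u n" "\<And>n. e n *\<^sub>R u n = D - D * u n"
    "\<And>n. norm (u n) \<le> 2" "\<And>n y. norm (y - u n * y) \<le> norm y"
    by metis
  have "u n \<in> J" for n
  proof -
    have "e n *\<^sub>R u n \<in> J" unfolding u(2) by (intro diff_mem D mult_mem_right)
    then have "(1 / e n) *\<^sub>R (e n *\<^sub>R u n) \<in> J" by (rule scaleR_mem)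
    then show ?thesis using e[of n] by simp
  qed
  then have zu: "z * u n \<in> J" for n by (rule mult_mem_left)
  have bd: "norm (z - z * u n) \<le> sqrt (2 * e n)" for n
  proof (rule real_le_rsqrt)
    have "norm (z - z * u n) \<le> norm (k - k * u n)"
      using norm_diff_mult_mono[of k z 1 "u n"] le by (simp add: psd_star[OF k(1)] k(2))
    then have "(norm (z - z * u n))\<^sup>2 \<le> (norm (k - k * u n))\<^sup>2" by (rule power_mono) simp
    also have "\<dots> = norm (star (k - k * u n) * (k - k * u n))" by (rule cstar_identity[symmetric])
    also have "star (k - k * u n) * (k - k * u n) = e n *\<^sub>R u n - u n * (e n *\<^sub>R u n)"
      unfolding u(2) k(2)[symmetric] by (simp add: star_diff star_mult psd_star[OF k(1)] u(1) algebra_simps)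
    also have "norm (e n *\<^sub>R u n - u n * (e n *\<^sub>R u n)) \<le> norm (e n *\<^sub>R u n)" by (rule u(4))
    also have "\<dots> \<le> e n * 2" using e[of n] u(3)[of n] by simp
    finally show "(norm (z - z * u n))\<^sup>2 \<le> 2 * e n" by simp
  qed
  have "(\<lambda>n. sqrt (2 * e n)) \<longlonglongrightarrow> sqrt (2 * 0)"
    unfolding e_def by (intro tendsto_intros LIMSEQ_Suc[OF lim_1_over_n])
  then have "(\<lambda>n. z - z * u n) \<longlonglongrightarrow> 0"
    using Lim_null_comparison[of "\<lambda>n. z - z * u n" "\<lambda>n. sqrt (2 * e n)" sequentially] bd by simp
  from tendsto_diff[OF tendsto_const[of z] this] have "(\<lambda>n. z * u n) \<longlonglongrightarrow> z" by simp
  then show ?thesis by (rule closed_sequentially[OF closed zu])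
qed

text \<open>The square root of a positive element of \<open>J\<close> lies in \<open>J\<close> by
  \<open>mem_of_psd_diff\<close>.\<close>

lemma cstar_pos_iff: "x \<in> cstar_pos J \<longleftrightarrow> x \<in> J \<and> psd x"
proof
  assume "x \<in> J \<and> psd x"
  moreover obtain h where h: "psd h" "h * h = x" using psd_sqrt calculation by blast
  moreover have "psd (x - star h * h)" by (simp add: psd_star[OF h(1)] h(2))
  ultimately have "h \<in> J" "x = star h * h" using mem_of_psd_diff psd_star by metis+
  then show "x \<in> cstar_pos J" unfolding cstar_pos_def by blast
qed (auto simp: cstar_pos_def psd_star_mult_self mult_mem_left)

text \<open>Each \<open>star (z k) * z k\<close> lies below \<open>x\<close>, so the implementing
  elements automatically belong to \<open>J\<close>.\<close>

lemma cstar_equiv_of_sim: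
  assumes x: "x \<in> J" and sim: "sim x y"
  shows "cstar_equiv J x y"
proof -
  obtain z where z: "(\<lambda>k. star (z k) * z k) sums x" "(\<lambda>k. z k * star (z k)) sums y"
    using sim unfolding sim_def by blast
  have zJ: "z k \<in> J" for k
    using mem_of_psd_diff[OF x] psd_sums_diff_term[OF z(1)] psd_star_mult_self by blast
  then have "y \<in> J" by (intro sums_mem[OF _ z(2)] mult_mem_right)
  then show ?thesis
    using x sim_psd[OF sim] zJ z unfolding cstar_equiv_def cstar_pos_iff by blast
qed

end

text \<open>\<open>y\<close> absorbs any number of copies of \<open>d\<close>. Splitting off
  \<open>n + 1\<close> copies of \<open>j\<close> gives an equivalent part of \<open>y\<close>, and
  dividing by \<open>n + 1\<close> makes it small.\<close>

lemma sim_small_of_not_finite: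
  assumes y: "psd y" and sim: "sim (y + d) y" and j: "psd j" "psd (d - j)"
  obtains w where "sim j w" "norm w \<le> norm y / real (Suc n)"
proof -
  have d: "psd d" using psd_add[OF j] by simp
  have "sim (y + real m *\<^sub>R d) y" for m
  proof (induction m)
    case (Suc m)
    have "sim (y + real m *\<^sub>R d + d) (y + d)" by (intro sim_add Suc sim_refl d)
    then have "sim (y + real m *\<^sub>R d + d) y" using sim by (rule sim_trans)
    then show ?case by (simp add: algebra_simps)
  qed (simp add: sim_refl y)
  then have "sim (real (Suc n) *\<^sub>R j + (y + real (Suc n) *\<^sub>R (d - j))) y"
    by (metis (no_types, lifting) add.commute add.left_commute diff_add_cancel scaleR_right_distrib)
  then obtain w q where w: "y = w + q" "sim (real (Suc n) *\<^sub>R j) w"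
    "sim (y + real (Suc n) *\<^sub>R (d - j)) q"
    by (rule sim_split) (intro psd_add psd_scaleR y j; simp)+
  show ?thesis
  proof (rule that)
    show "sim j ((1 / real (Suc n)) *\<^sub>R w)"
      using sim_scaleR[OF w(2), of "1 / real (Suc n)"] by simp
    have "norm w \<le> norm y"
      by (rule psd_norm_mono) (use w sim_psd in auto)
    then show "norm ((1 / real (Suc n)) *\<^sub>R w) \<le> norm y / real (Suc n)"
      by (simp add: divide_right_mono)
  qed
qed

lemma cstar_prime_finite_ideal_imp_finite:
  assumes prime: "cstar_prime (UNIV :: 'a::cstar_algebra set)"
    and J: "cstar_ideal UNIV J" "closed J" "J \<noteq> {0 :: 'a}" and fin: "cstar_finite J"
  shows "cstar_finite (UNIV :: 'a set)"
proof -
  interpret closed_cstar_ideal J by unfold_locales (fact J)+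
  have "y = a" if y: "psd y" "psd (a - y)" "sim y a" for a y :: 'a
  proof (rule ccontr)
    assume "y \<noteq> a"
    obtain s where s: "psd s" "s * s = a - y" using psd_sqrt[OF y(2)] by blast
    have "s \<noteq> 0" using s(2) \<open>y \<noteq> a\<close> by auto
    obtain x where x: "x \<in> J" "x \<noteq> 0" using J(3) zero_mem by blast
    obtain c where c: "norm (x * c) \<le> 1" "x * c * s \<noteq> 0"
      using cstar_prime_connecting[OF prime x(2) \<open>s \<noteq> 0\<close>] by blast
    define j where "j = star (x * c * s) * (x * c * s)"
    have j: "psd j" "j \<in> J" "j \<noteq> 0"
      using c(2) x(1) by (simp_all add: j_def psd_star_mult_self mult_mem_left mult_mem_right
          star_mult_self_eq_0)
    have jd: "psd ((a - y) - j)"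
      using psd_diff_contraction[OF c(1), of s] by (simp add: j_def psd_star[OF s(1)] s(2))
    have "sim (y + (a - y)) y" using sim_sym[OF y(3)] by simp
    note small = sim_small_of_not_finite[OF y(1) this j(1) jd]
    \<comment> \<open>Using \<open>2 ^ n + 1\<close> copies gives the geometric decay needed for
      summability.\<close>
    have "\<exists>w. sim j w \<and> norm w \<le> norm y * (1 / 2) ^ n" for n
    proof -
      obtain w where w: "sim j w" "norm w \<le> norm y / real (Suc (2 ^ n))" using small by blast
      have "norm y / real (Suc (2 ^ n)) \<le> norm y / 2 ^ n" by (intro divide_left_mono) (auto intro!: mult_pos_pos add_pos_pos)
      then show ?thesis using w by (intro exI[of _ w]) (simp add: power_one_over)
    qed
    then obtain W where W: "\<And>n. sim j (W n)" "\<And>n. norm (W n) \<le> norm y * (1 / 2) ^ n" by metis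
    have WJ: "W n \<in> J" "psd (W n)" for n
      using cstar_equiv_of_sim[OF j(2) W(1)] by (simp_all add: cstar_equiv_def cstar_pos_iff)
    have "summable W"
      by (rule summable_comparison_test[where g = "\<lambda>n. norm y * (1 / 2) ^ n"])
        (use W(2) in \<open>auto intro!: summable_mult summable_geometric\<close>)
    then obtain h where h: "W sums h" by blast
    then have h': "(\<lambda>n. W (Suc n)) sums (h - W 0)" by (simp add: sums_Suc_iff)
    have hJ: "h \<in> J" "psd h" using sums_mem[OF WJ(1) h] psd_sums[OF h WJ(2)] by auto
    have h'J: "h - W 0 \<in> J" "psd (h - W 0)"
      using sums_mem[OF WJ(1) h'] psd_sums[OF h' WJ(2)] by auto
    have W0: "W 0 \<noteq> 0" using W(1)[of 0] j(3) sim_zero_right by force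
    have "h \<noteq> 0" using psd_antisym[OF WJ(2), of 0] W0 h'J(2) by auto
    moreover have "h \<in> cstar_pos J" using hJ by (simp add: cstar_pos_iff)
    ultimately have "finite_in J h" using fin unfolding cstar_finite_def by blast
    \<comment> \<open>All \<open>W n\<close> are equivalent to \<open>j\<close>, so the shifted
      series is termwise equivalent to the original.\<close>
    moreover have "sim (h - W 0) h"
      by (rule sim_sums[OF _ h' h]) (use W(1) sim_sym sim_trans in blast)
    then have "cstar_equiv J (h - W 0) h" by (rule cstar_equiv_of_sim[OF h'J(1)])
    moreover have "cstar_le J (h - W 0) h" using WJ by (simp add: cstar_le_def cstar_pos_iff)
    moreover have "h - W 0 \<in> cstar_pos J" using h'J by (simp add: cstar_pos_iff)
    ultimately have "h - W 0 = h" unfolding finite_in_def by blast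
    then show False using W0 by simp
  qed
  then have "finite_in UNIV a" if "psd a" for a :: 'a
    unfolding finite_in_UNIV_iff using that by blast
  then show ?thesis by (simp add: cstar_finite_def cstar_pos_UNIV_iff)
qed

theorem corollary1p5:
  assumes "cstar_prime (UNIV :: 'a::cstar_algebra set)"
  shows "(cstar_discrete (UNIV :: 'a set) \<and> cstar_finite (UNIV :: 'a set)) \<or>
         (cstar_discrete (UNIV :: 'a set) \<and> cstar_essentially_infinite (UNIV :: 'a set)) \<or>
         (cstar_type_II (UNIV :: 'a set) \<and> cstar_finite (UNIV :: 'a set)) \<or>
         (cstar_type_II (UNIV :: 'a set) \<and> cstar_essentially_infinite (UNIV :: 'a set)) \<or>
         cstar_type_III (UNIV :: 'a set)"
proof -
  have "cstar_finite (UNIV :: 'a set) \<or> cstar_essentially_infinite (UNIV :: 'a set)"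
    unfolding cstar_essentially_infinite_def
    using cstar_prime_finite_ideal_imp_finite[OF assms] by blast
  \<comment> \<open>A non-zero abelian element gives discreteness. Failing that, a non-zero finite
    element gives type II, and its absence is type III.\<close>
  moreover have "cstar_discrete (UNIV :: 'a set) \<or> cstar_type_II (UNIV :: 'a set)
      \<or> cstar_type_III (UNIV :: 'a set)"
    unfolding cstar_type_II_def cstar_type_III_def
    using cstar_prime_abelian_imp_discrete[OF assms] cstar_prime_finite_imp_semifinite[OF assms]
    by blast
  ultimately show ?thesis by blast
qed

end
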